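(* Let $1\le r\le\infty$, $r'=r/(r-1)$, let $\mathcal G=(V,E)$ be a connected simple graph with Beurling dimension $d$ whose counting measure $\mu$ is doubling, and let $\alpha>d/r'$. Let $K_0$ be a positive integer with $K_0>\dfrac{d}{\min(\alpha-d/r',1)}$, and for $1\le p,q\le\infty$ put $$\theta(p,q)=\frac{d|1/p-1/q|}{K_0\min(\alpha-d/r',1)-d|1/p-1/q|}.$$ Then there exists a constant $C>0$, independent of matrices $A\in\mathcal B_{r,\alpha}(\mathcal G)$ and of exponents $1\le p,q\le\infty$, such that the following holds. Let $1\le p,q\le\infty$ and $A\in\mathcal B_{r,\alpha}(\mathcal G)$. If there is a positive constant $A_p$ with $$\|Ac\|_p\ge A_p\|c\|_p\quad\text{for all }c\in\ell^p,$$ then there is a positive constant $A_q$ with $$\|Ad\|_q\ge A_q\|d\|_q\quad\text{for all }d\in\ell^q,$$ and moreover $A_q$ satisfies $$\frac{\|A\|_{\mathcal B_{r,\alpha}}}{A_q}\le C\Big(\frac{\|A\|_{\mathcal B_{r,\alpha}}}{A_p}\Big)^{(1+\theta(p,q))^{K_0}}\quad\text{if }\alpha\ne 1+d/r',$$ $$\frac{\|A\|_{\mathcal B_{r,\alpha}}}{A_q}\le C\Big(\frac{\|A\|_{\mathcal B_{r,\alpha}}}{A_p}\ln\Big(1+\frac{\|A\|_{\mathcal B_{r,\alpha}}}{A_p}\Big)\Big)^{(1+\theta(p,q))^{K_0}}\quad\text{if }\alpha=1+d/r'.$$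
   Context: A simple graph is an unweighted, undirected graph without loops or multiple edges. For a connected simple graph $\mathcal G=(V,E)$, $\rho(\lambda,\lambda')$ is the geodesic distance on $V$ (number of edges in a shortest path), $B(\lambda,R)=\{\lambda'\in V:\rho(\lambda,\lambda')\le R\}$, and $\mu$ is the counting measure on $V$. The counting measure is doubling if there is a constant $D_0(\mathcal G)>0$ with $\mu(B(\lambda,2R))\le D_0(\mathcal G)\mu(B(\lambda,R))$ for all $\lambda\in V$, $R\ge0$. It has polynomial growth if there are positive constants $D_1(\mathcal G)$ and $d$ with $\mu(B(\lambda,R))\le D_1(\mathcal G)(R+1)^d$ for all $\lambda\in V$, $R\ge0$; the minimal constants $d$ and $D_1(\mathcal G)$ are called the Beurling dimension and density of $\mathcal G$. For a matrix $A=(a(\lambda,\lambda'))_{\lambda,\lambda'\in V}$ put $h_A(n)=\sup_{\rho(\lambda,\lambda')\ge n}|a(\lambda,\lambda')|$, $n\ge0$. For $1\le r\le\infty$, $\alpha\ge0$, $$\|A\|_{\mathcal B_{r,\alpha}}=\Big(\sum_{n=0}^\infty h_A(n)^r(n+1)^{\alpha r+d-1}\Big)^{1/r}\ (1\le r<\infty),\qquad \|A\|_{\mathcal B_{\infty,\alpha}}=\sup_{n\ge0}h_A(n)(n+1)^\alpha,$$ and $\mathcal B_{r,\alpha}(\mathcal G)$ is the set of all $A$ with $\|A\|_{\mathcal B_{r,\alpha}}<\infty$. $\ell^p=\ell^p(V)$ is the space of $p$-summable sequences on $V$ with its standard norm $\|\cdot\|_p$. Convention: $r'=\infty$, $1/r'=0$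 if $r=1$, and $r'=1$ if $r=\infty$. The constant $C$ may depend on $\mathcal G,r,\alpha,K_0$. (In the $\ell^q$-stability inequality $d$ denotes a sequence; elsewhere $d$ is the Beurling dimension.) *)

theory Defs
  imports "HOL-Analysis.Analysis"
begin

section \<open>Simple graphs with the geodesic distance and the counting measure\<close>

definition simple_graph :: "'a set \<Rightarrow> 'a set set \<Rightarrow> bool" where
  "simple_graph V E \<longleftrightarrow> (\<forall>e\<in>E. e \<subseteq> V \<and> card e = 2)"

definition adjacency :: "'a set set \<Rightarrow> ('a \<times> 'a) set" where
  "adjacency E = {(x, y). {x, y} \<in> E}"

definition connected_graph :: "'a set \<Rightarrow> 'a set set \<Rightarrow> bool" where
  "connected_graph V E \<longleftrightarrow> V \<noteq> {} \<and> (\<forall>x\<in>V. \<forall>y\<in>V. (x, y) \<in> (adjacency E)\<^sup>*)"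

text \<open>
  A pair lies in the \<open>n\<close>-th relational power of the adjacency relation iff it is joined by a walk
  with \<open>n\<close> edges; a shortest walk is a shortest path.  Only meaningful for pairs in the same
  connected component.
\<close>
definition geodesic_dist :: "'a set set \<Rightarrow> 'a \<Rightarrow> 'a \<Rightarrow> nat" where
  "geodesic_dist E x y = (LEAST n. (x, y) \<in> adjacency E ^^ n)"

definition graph_ball :: "'a set \<Rightarrow> 'a set set \<Rightarrow> 'a \<Rightarrow> real \<Rightarrow> 'a set" where
  "graph_ball V E x R = {y \<in> V. real (geodesic_dist E x y) \<le> R}"

definition doubling_graph :: "'a set \<Rightarrow> 'a set set \<Rightarrow> bool" where
  "doubling_graph V E \<longleftrightarrow> (\<exists>D0>0. \<forall>x\<in>V. \<forall>R\<ge>0.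
     emeasure (count_space V) (graph_ball V E x (2 * R))
       \<le> ennreal D0 * emeasure (count_space V) (graph_ball V E x R))"

definition growth_exponent :: "'a set \<Rightarrow> 'a set set \<Rightarrow> real \<Rightarrow> bool" where
  "growth_exponent V E d \<longleftrightarrow> d > 0 \<and> (\<exists>D1>0. \<forall>x\<in>V. \<forall>R\<ge>0.
     emeasure (count_space V) (graph_ball V E x R) \<le> ennreal (D1 * (R + 1) powr d))"

text \<open>
  The Beurling dimension is the minimal admissible exponent, so the minimum is attained:
  \<open>d\<close> itself is admissible.  This entails polynomial growth.
\<close>
definition beurling_dimension :: "'a set \<Rightarrow> 'a set set \<Rightarrow> real \<Rightarrow> bool" where
  "beurling_dimension V E d \<longleftrightarrow>
     growth_exponent V E d \<and> (\<forall>d'. growth_exponent V E d' \<longrightarrow> d \<le> d')"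

section \<open>Exponents\<close>

text \<open>Exponents range over \<open>[1, \<infinity>]\<close>; since \<open>1 / \<infinity> = 0\<close> in \<open>ennreal\<close>, the reciprocal of \<open>\<infinity>\<close> is \<open>0\<close>.\<close>
definition recip :: "ennreal \<Rightarrow> real" where
  "recip p = enn2real (1 / p)"

definition conjugate_exponent :: "ennreal \<Rightarrow> ennreal" where
  "conjugate_exponent r = (if r = 1 then \<infinity> else if r = \<infinity> then 1 else r / (r - 1))"

text \<open>Real powers of extended nonnegative numbers, used for positive exponents only.\<close>
definition ennreal_powr :: "ennreal \<Rightarrow> real \<Rightarrow> ennreal" where
  "ennreal_powr x s = (if x = \<infinity> then \<infinity> else ennreal (enn2real x powr s))"

section \<open>Sequence spaces\<close>

definition lp_norm :: "'a set \<Rightarrow> ennreal \<Rightarrow> ('a \<Rightarrow> complex) \<Rightarrow> ennreal" where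
  "lp_norm V p c =
     (if p = \<infinity> then (SUP x\<in>V. ennreal (norm (c x)))
      else ennreal_powr (\<Sum>\<^sub>\<infinity>x\<in>V. ennreal (norm (c x) powr enn2real p)) (1 / enn2real p))"

definition lp_space :: "'a set \<Rightarrow> ennreal \<Rightarrow> ('a \<Rightarrow> complex) set" where
  "lp_space V p = {c. lp_norm V p c < \<infinity>}"

section \<open>The Beurling classes of matrices\<close>

definition mat_apply :: "'a set \<Rightarrow> ('a \<Rightarrow> 'a \<Rightarrow> complex) \<Rightarrow> ('a \<Rightarrow> complex) \<Rightarrow> 'a \<Rightarrow> complex" where
  "mat_apply V A c x = (\<Sum>\<^sub>\<infinity>y\<in>V. A x y * c y)"

definition offdiag_sup :: "'a set \<Rightarrow> 'a set set \<Rightarrow> ('a \<Rightarrow> 'a \<Rightarrow> complex) \<Rightarrow> nat \<Rightarrow> ennreal" where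
  "offdiag_sup V E A n =
     (SUP (x, y) \<in> {(x, y). x \<in> V \<and> y \<in> V \<and> n \<le> geodesic_dist E x y}. ennreal (norm (A x y)))"

definition beurling_norm ::
  "'a set \<Rightarrow> 'a set set \<Rightarrow> real \<Rightarrow> ennreal \<Rightarrow> real \<Rightarrow> ('a \<Rightarrow> 'a \<Rightarrow> complex) \<Rightarrow> ennreal" where
  "beurling_norm V E d r \<alpha> A =
     (if r = \<infinity> then (SUP n. offdiag_sup V E A n * ennreal (real (n + 1) powr \<alpha>))
      else ennreal_powr
        (\<Sum>n. ennreal_powr (offdiag_sup V E A n) (enn2real r)
               * ennreal (real (n + 1) powr (\<alpha> * enn2real r + d - 1)))
        (1 / enn2real r))"

definition beurling_class ::
  "'a set \<Rightarrow> 'a set set \<Rightarrow> real \<Rightarrow> ennreal \<Rightarrow> real \<Rightarrow> ('a \<Rightarrow> 'a \<Rightarrow> complex) set" where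
  "beurling_class V E d r \<alpha> = {A. beurling_norm V E d r \<alpha> A < \<infinity>}"

section \<open>Stability\<close>

definition lp_stable ::
  "'a set \<Rightarrow> ennreal \<Rightarrow> ('a \<Rightarrow> 'a \<Rightarrow> complex) \<Rightarrow> real \<Rightarrow> bool" where
  "lp_stable V p A a \<longleftrightarrow>
     (\<forall>c\<in>lp_space V p. lp_norm V p (mat_apply V A c) \<ge> ennreal a * lp_norm V p c)"

definition stability_theta ::
  "real \<Rightarrow> ennreal \<Rightarrow> real \<Rightarrow> nat \<Rightarrow> ennreal \<Rightarrow> ennreal \<Rightarrow> real" where
  "stability_theta d r \<alpha> K\<^sub>0 p q =
     d * \<bar>recip p - recip q\<bar>
       / (real K\<^sub>0 * min (\<alpha> - d * recip (conjugate_exponent r)) 1 - d * \<bar>recip p - recip q\<bar>)"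

end

(*
By monotonicity of offdiag_sup, every A in the class satisfies |A x y| <= C ||A|| (rho x y + 1)^-(d+s) with
s = alpha - d/r', so only this decay matters.  For a cutoff psi at scale N around a centre m, the commutator
of A with psi is dominated by this decay times min 1 ((rho x y + 1)/N), a kernel whose row sums are
O(||A|| N^-min(s,1)), with an additional logarithm if s = 1.  Applying l^p stability to psi c and passing between
l^p and l^q on the ball of radius 4N costs a factor N^(d|1/p - 1/q|).  Averaging over m (doubling) gives
||c||_q <= C N^(d|1/p-1/q|)/A_p (||Ac||_q + ||A|| N^-min(s,1) ||c||_q), and the last term is absorbed for
large N provided d|1/p-1/q| < min(s,1).  In general one moves from p to q in K0 steps of equal length in 1/p.
*)

theory Submission
  imports Defs
begin

subsection \<open>Sequence norms\<close>

text \<open>Off the ball of radius 4N the vector A (psi c) is not finitely supported, so its l^p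
  norm cannot be reached from an l^q norm by Hoelder. It is bounded in l^p directly, by Schur's test
  applied to psi c; the row sum \<kappa> that appears is compensated by putting \<kappa> |c| into
  the local right-hand side, which gives |psi c| at most 1/\<kappa> times that side, and \<kappa>
  cancels.

  The other point is uniformity. Put t = ||A|| / A_p and L(t) = 1, or ln (1 + t) if s = 1. One step
  replaces t by a multiple of t (t L(t))^\<theta>. Iteration preserves the shape t^e L(t)^(e-1),
  since the logarithm of a quantity polynomially bounded in t is O(L(t)) again; L(t)^(e-1) is
  enlarged to L(t)^e at the very end. These comparisons need t bounded below, which follows from
  testing stability on a unit vector. Equal steps in 1/p give the same \<theta> each time, hence the
  exponent (1 + \<theta>)^K0. As no constant may depend on p or q, the norm inequalities are
  arranged so that their crude factors 2 and 4 stay outside the p-th power.\<close>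

lemma nn_integral_count_space_eq_infsum:
  fixes f :: "'a \<Rightarrow> ennreal"
  shows "(\<integral>\<^sup>+x. f x \<partial>count_space A) = infsum f A"
proof (rule antisym)
  show "infsum f A \<le> (\<integral>\<^sup>+x. f x \<partial>count_space A)"
    unfolding nonneg_infsum_complete[of A f, OF zero_le]
  proof (rule SUP_least)
    fix F assume "F \<in> {F. finite F \<and> F \<subseteq> A}"
    then have F: "finite F" "F \<subseteq> A" by auto
    have "sum f F = (\<integral>\<^sup>+x. f x \<partial>count_space F)"
      using F by (simp add: nn_integral_count_space_finite)
    also have "\<dots> = (\<integral>\<^sup>+x. f x * indicator F x \<partial>count_space A)"
      using F by (subst (1 2) nn_integral_count_space_indicator)
        (auto intro!: nn_integral_cong split: split_indicator)
    also have "\<dots> \<le> (\<integral>\<^sup>+x. f x \<partial>count_space A)"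
      by (intro nn_integral_mono) (auto split: split_indicator)
    finally show "sum f F \<le> (\<integral>\<^sup>+x. f x \<partial>count_space A)" .
  qed
  show "(\<integral>\<^sup>+x. f x \<partial>count_space A) \<le> infsum f A"
  proof (cases "infsum f A = \<infinity>")
    case False
    have le: "sum f F \<le> infsum f A" if "finite F" "F \<subseteq> A" for F
      unfolding nonneg_infsum_complete[of A f, OF zero_le]
      using that by (intro SUP_upper) auto
    have fin: "f x < \<infinity>" if "x \<in> A" for x
    proof -
      have "f x \<le> infsum f A" using le[of "{x}"] that by simp
      also have "\<dots> < \<infinity>" using False by (metis infinity_ennreal_def less_top)
      finally show ?thesis .
    qed
    define g where "g x = enn2real (f x)" for x
    have g: "f x = ennreal (g x)" if "x \<in> A" for x
      using fin[OF that] by (simp add: g_def)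
    have g0: "g x \<ge> 0" for x by (simp add: g_def)
    have gsum: "ennreal (sum g F) = sum f F" if "finite F" "F \<subseteq> A" for F
    proof -
      have "ennreal (sum g F) = (\<Sum>x\<in>F. ennreal (g x))" using g0 by (simp add: sum_ennreal)
      also have "\<dots> = sum f F" using that g by (intro sum.cong) auto
      finally show ?thesis .
    qed
    have "g summable_on A"
    proof (rule nonneg_bdd_above_summable_on[OF g0])
      show "bdd_above (sum g ` {F. F \<subseteq> A \<and> finite F})"
      proof (rule bdd_aboveI2)
        fix F assume "F \<in> {F. F \<subseteq> A \<and> finite F}"
        then have "ennreal (sum g F) \<le> infsum f A" using le gsum by auto
        then show "sum g F \<le> enn2real (infsum f A)"
          using False by (metis enn2real_ennreal enn2real_mono g0 infinity_ennreal_def less_top sum_nonneg)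
      qed
    qed
    then have "(\<lambda>x. norm (g x)) summable_on A"
      using g0 by (simp add: abs_of_nonneg)
    then have abs: "Infinite_Set_Sum.abs_summable_on g A"
      by (rule iffD1[OF abs_summable_equivalent])
    have "(\<integral>\<^sup>+x. f x \<partial>count_space A) = (\<integral>\<^sup>+x. ennreal (g x) \<partial>count_space A)"
      by (intro nn_integral_cong) (auto simp: g)
    also have "\<dots> = ennreal (infsum g A)"
      using nn_integral_conv_infsetsum[OF abs] infsetsum_infsum[OF abs] g0 by simp
    also have "\<dots> = (SUP F\<in>{F. finite F \<and> F \<subseteq> A}. ennreal (sum g F))"
      using \<open>g summable_on A\<close> g0 by (rule infsum_nonneg_is_SUPREMUM_ennreal)
    also have "\<dots> \<le> infsum f A"
      using gsum le by (intro SUP_least) auto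
    finally show ?thesis .
  qed simp
qed

text \<open>Tonelli without sigma-finiteness, for arbitrary index sets: both iterated sums equal the
  sum over the counting measure on pairs, and the indicators reduce \<open>A\<close> and
  \<open>B\<close> to \<open>UNIV\<close>.\<close>

lemma nn_integral_count_space_commute:
  fixes f :: "'a \<Rightarrow> 'b \<Rightarrow> ennreal"
  shows "(\<integral>\<^sup>+x. (\<integral>\<^sup>+y. f x y \<partial>count_space B) \<partial>count_space A)
       = (\<integral>\<^sup>+y. (\<integral>\<^sup>+x. f x y \<partial>count_space A) \<partial>count_space B)"
proof -
  define g where "g = (\<lambda>(x, y). f x y * indicator B y * indicator A x)"
  have "(\<integral>\<^sup>+x. (\<integral>\<^sup>+y. f x y \<partial>count_space B) \<partial>count_space A)
      = (\<integral>\<^sup>+x. \<integral>\<^sup>+y. g (x, y) \<partial>count_space UNIV \<partial>count_space UNIV)"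
    by (simp add: g_def nn_integral_count_space_indicator nn_integral_multc)
  also have "\<dots> = (\<integral>\<^sup>+y. \<integral>\<^sup>+x. g (x, y) \<partial>count_space UNIV \<partial>count_space UNIV)"
    by (simp only: nn_integral_fst_count_space nn_integral_snd_count_space)
  also have "\<dots> = (\<integral>\<^sup>+y. \<integral>\<^sup>+x. f x y * indicator A x * indicator B y \<partial>count_space UNIV \<partial>count_space UNIV)"
    by (intro nn_integral_cong) (auto simp: g_def split: split_indicator)
  also have "\<dots> = (\<integral>\<^sup>+y. (\<integral>\<^sup>+x. f x y \<partial>count_space A) \<partial>count_space B)"
    by (simp add: nn_integral_count_space_indicator nn_integral_multc)
  finally show ?thesis .
qed

section \<open>Exponents and their reciprocals\<close>

lemma enn2real_ge_1: "1 \<le> p \<Longrightarrow> p \<noteq> \<infinity> \<Longrightarrow> 1 \<le> enn2real p"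
  by (metis enn2real_1 enn2real_mono infinity_ennreal_def less_top)

lemma recip_top [simp]: "recip top = 0"
  by (simp add: recip_def)

lemma recip_finite: "1 \<le> p \<Longrightarrow> p \<noteq> \<infinity> \<Longrightarrow> recip p = 1 / enn2real p"
proof -
  assume "1 \<le> p" "p \<noteq> \<infinity>"
  then have "p = ennreal (enn2real p)" "enn2real p \<ge> 1" 
    using enn2real_ge_1 by (auto simp: less_top)
  then obtain P where "p = ennreal P" "P \<ge> 1" by blast
  then show ?thesis
    by (simp add: recip_def divide_ennreal flip: ennreal_1)
qed

lemma recip_bounds: "1 \<le> p \<Longrightarrow> 0 \<le> recip p \<and> recip p \<le> 1"
  using enn2real_ge_1[of p] by (cases "p = \<infinity>") (auto simp: recip_finite)

text \<open>Supplies the intermediate exponents of a chain, which is prescribed by its values 1/p;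
  the value 0 stands for the exponent \<infinity>.\<close>

lemma ex_recip:
  assumes "0 \<le> t" "t \<le> 1"
  shows "\<exists>p\<ge>1. recip p = t"
proof (cases "t = 0")
  case True
  then show ?thesis by (intro exI[of _ \<infinity>]) auto
next
  case False
  then have t: "t > 0" "1 \<le> 1 / t" using assms by auto
  then have "1 \<le> ennreal (1 / t)" by (simp flip: ennreal_1 del: ennreal_1)
  then show ?thesis
    using t assms by (intro exI[of _ "ennreal (1 / t)"]) (auto simp: recip_finite)
qed

text \<open>Identifies the endpoints of such a chain with the given exponents.\<close>

lemma recip_inject: "1 \<le> p \<Longrightarrow> 1 \<le> q \<Longrightarrow> recip p = recip q \<Longrightarrow> p = q"
proof -
  assume h: "1 \<le> p" "1 \<le> q" "recip p = recip q"
  have top: "x = top" if "recip x = 0" "1 \<le> x" for x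
    using that recip_finite[of x] enn2real_ge_1[of x] by fastforce
  have fin: "x = ennreal (1 / recip x)" if "x \<noteq> top" "1 \<le> x" for x
    using recip_finite[of x] that by (simp add: less_top)
  show ?thesis
  proof (cases "p = top \<or> q = top")
    case True
    then have "recip p = 0" "recip q = 0" using h(3) by auto
    then show ?thesis using h top by metis
  next
    case False
    then show ?thesis using fin[of p] fin[of q] h by metis
  qed
qed

lemma recip_conjugate_exponent:
  assumes "1 \<le> r"
  shows "recip (conjugate_exponent r) = 1 - recip r"
proof -
  consider "r = 1" | "r = \<infinity>" | "r \<noteq> 1" "r \<noteq> \<infinity>" by blast
  then show ?thesis
  proof cases
    case 3
    then have "r = ennreal (enn2real r)" "enn2real r \<ge> 1" 
      using enn2real_ge_1 assms by (auto simp: less_top)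
    then obtain R where R: "r = ennreal R" "R \<ge> 1" by blast
    with 3 have "R > 1" by (cases "R = 1") auto
    have "conjugate_exponent r = ennreal R / (ennreal R - ennreal 1)"
      using 3 R by (simp add: conjugate_exponent_def)
    also have "\<dots> = ennreal (R / (R - 1))"
      using \<open>R > 1\<close> by (subst ennreal_minus) (auto simp: divide_ennreal)
    finally have "conjugate_exponent r = ennreal (R / (R - 1))" .
    then have "recip (conjugate_exponent r) = enn2real (ennreal 1 / ennreal (R / (R - 1)))"
      by (simp add: recip_def)
    also have "\<dots> = 1 - 1 / R"
      using \<open>R > 1\<close> by (subst divide_ennreal) (auto simp: field_simps)
    finally show ?thesis using R 3 assms by (simp add: recip_finite)
  qed (auto simp: recip_def conjugate_exponent_def)
qed

section \<open>Bounds for l^p norms\<close>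

lemma ennreal_powr_le_iff:
  assumes "s > 0" "K \<ge> 0"
  shows "ennreal_powr x (1 / s) \<le> ennreal K \<longleftrightarrow> x \<le> ennreal (K powr s)"
proof (cases x rule: ennreal_cases)
  case (real t)
  have "t powr (1 / s) \<le> K \<longleftrightarrow> t \<le> K powr s"
  proof
    assume "t powr (1 / s) \<le> K"
    then have "(t powr (1 / s)) powr s \<le> K powr s"
      using assms by (intro powr_mono2) auto
    then show "t \<le> K powr s" using assms real by (simp add: powr_powr)
  next
    assume "t \<le> K powr s"
    then have "t powr (1 / s) \<le> (K powr s) powr (1 / s)"
      using assms real by (intro powr_mono2) auto
    then show "t powr (1 / s) \<le> K" using assms real by (simp add: powr_powr)
  qed
  then show ?thesis using real assms by (simp add: ennreal_powr_def)
qed (simp add: ennreal_powr_def top_unique)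

text \<open>Turns a norm estimate into one between p-th powers under the integral; the real bound
  \<open>K\<close> makes finiteness part of the estimate.\<close>

lemma lp_norm_le_iff:
  assumes "1 \<le> p" "p \<noteq> \<infinity>" "K \<ge> 0"
  shows "lp_norm V p c \<le> ennreal K \<longleftrightarrow>
    (\<integral>\<^sup>+x. ennreal (norm (c x) powr enn2real p) \<partial>count_space V) \<le> ennreal (K powr enn2real p)"
  using assms enn2real_ge_1[of p]
  by (simp add: lp_norm_def ennreal_powr_le_iff nn_integral_count_space_eq_infsum)

lemma lp_norm_top_le_iff:
  assumes "K \<ge> 0"
  shows "lp_norm V top c \<le> ennreal K \<longleftrightarrow> (\<forall>x\<in>V. norm (c x) \<le> K)"
  using assms by (simp add: lp_norm_def SUP_le_iff)

lemma lp_norm_mono: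
  assumes "1 \<le> p" "\<And>x. x \<in> V \<Longrightarrow> norm (c x) \<le> norm (f x)"
  shows "lp_norm V p c \<le> lp_norm V p f"
proof (cases "lp_norm V p f" rule: ennreal_cases)
  case (real K)
  then have "lp_norm V p f \<le> ennreal K" by simp
  then have "lp_norm V p c \<le> ennreal K"
  proof (cases "p = \<infinity>")
    case True
    then show ?thesis using \<open>lp_norm V p f \<le> ennreal K\<close> assms(2) real
      by (auto simp: lp_norm_top_le_iff intro: order_trans)
  next
    case False
    have "(\<integral>\<^sup>+x. ennreal (norm (c x) powr enn2real p) \<partial>count_space V)
       \<le> (\<integral>\<^sup>+x. ennreal (norm (f x) powr enn2real p) \<partial>count_space V)"
      using assms by (intro nn_integral_mono ennreal_leI powr_mono2) auto
    also have "\<dots> \<le> ennreal (K powr enn2real p)"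
      using \<open>lp_norm V p f \<le> ennreal K\<close> lp_norm_le_iff[OF assms(1) False, of K V f] real by simp
    finally show ?thesis using assms(1) False real by (simp add: lp_norm_le_iff)
  qed
  with real show ?thesis by simp
qed simp

lemma norm_le_lp_norm:
  assumes "1 \<le> p" "lp_norm V p c \<le> ennreal K" "K \<ge> 0" "x \<in> V"
  shows "norm (c x) \<le> K"
proof (cases "p = \<infinity>")
  case True
  then show ?thesis using assms by (simp add: lp_norm_top_le_iff)
next
  case False
  define P where "P = enn2real p"
  have P: "P \<ge> 1" using enn2real_ge_1[OF assms(1) False] by (simp add: P_def)
  have "ennreal (norm (c x) powr P) \<le> (\<integral>\<^sup>+x. ennreal (norm (c x) powr P) \<partial>count_space V)"
    using assms by (intro nn_integral_ge_point) auto
  also have "\<dots> \<le> ennreal (K powr P)"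
    using assms False by (simp add: lp_norm_le_iff P_def)
  finally have "norm (c x) powr P \<le> K powr P" by simp
  then show ?thesis
    using P assms(3) by (meson norm_ge_zero not_le powr_less_mono2 zero_less_one order_less_le_trans)
qed

lemma lp_norm_scale:
  assumes "1 \<le> p" "lp_norm V p c \<le> ennreal K" "K \<ge> 0"
    and "t \<ge> 0" "\<And>x. x \<in> V \<Longrightarrow> norm (f x) \<le> t * norm (c x)"
  shows "lp_norm V p f \<le> ennreal (t * K)"
proof (cases "p = \<infinity>")
  case True
  have "norm (f x) \<le> t * K" if "x \<in> V" for x
    using assms(5)[OF that] mult_left_mono[OF norm_le_lp_norm[OF assms(1-3) that] assms(4)] by simp
  then show ?thesis using True assms by (simp add: lp_norm_top_le_iff)
next
  case False
  define P where "P = enn2real p"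
  have P: "P \<ge> 1" using enn2real_ge_1[OF assms(1) False] by (simp add: P_def)
  have "(\<integral>\<^sup>+x. ennreal (norm (f x) powr P) \<partial>count_space V)
     \<le> (\<integral>\<^sup>+x. ennreal (t powr P) * ennreal (norm (c x) powr P) \<partial>count_space V)"
  proof (intro nn_integral_mono)
    fix x assume "x \<in> space (count_space V)"
    then have "norm (f x) powr P \<le> (t * norm (c x)) powr P"
      using assms P by (intro powr_mono2) auto
    then show "ennreal (norm (f x) powr P) \<le> ennreal (t powr P) * ennreal (norm (c x) powr P)"
      using assms by (simp add: powr_mult flip: ennreal_mult)
  qed
  also have "\<dots> = ennreal (t powr P) * (\<integral>\<^sup>+x. ennreal (norm (c x) powr P) \<partial>count_space V)"
    by (simp add: nn_integral_cmult)
  also have "\<dots> \<le> ennreal (t powr P) * ennreal (K powr P)"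
    using assms False by (intro mult_left_mono) (auto simp: lp_norm_le_iff P_def)
  finally show ?thesis
    using assms False by (simp add: lp_norm_le_iff P_def powr_mult flip: ennreal_mult)
qed

text \<open>The triangle inequality up to a constant independent of \<open>p\<close>: |f| + |g|
  \<le> 2 max(|f|, |g|) costs one factor 2, and F^P + G^P \<le> 2 (F + G)^P \<le> 2^P (F + G)^P
  costs the other.\<close>

lemma lp_norm_add_le:
  assumes p: "1 \<le> p" and f: "lp_norm V p f \<le> ennreal F" "F \<ge> 0"
    and g: "lp_norm V p g \<le> ennreal G" "G \<ge> 0"
    and c: "\<And>x. x \<in> V \<Longrightarrow> norm (c x) \<le> norm (f x) + norm (g x)"
  shows "lp_norm V p c \<le> ennreal (4 * (F + G))"
proof (cases "p = \<infinity>")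
  case True
  have "norm (c x) \<le> 4 * (F + G)" if "x \<in> V" for x
    using c[OF that] norm_le_lp_norm[OF p f that] norm_le_lp_norm[OF p g that] f(2) g(2)
    unfolding ring_distribs by linarith
  then show ?thesis
    using lp_norm_top_le_iff[of "4 * (F + G)" V c] True f(2) g(2) by simp
next
  case False
  define P where "P = enn2real p"
  have P: "P \<ge> 1" using enn2real_ge_1[OF p False] by (simp add: P_def)
  have "(\<integral>\<^sup>+x. ennreal (norm (c x) powr P) \<partial>count_space V)
     \<le> (\<integral>\<^sup>+x. ennreal (2 powr P) * (ennreal (norm (f x) powr P) + ennreal (norm (g x) powr P)) \<partial>count_space V)"
  proof (intro nn_integral_mono)
    fix x assume "x \<in> space (count_space V)"
    then have "norm (c x) powr P \<le> (2 * max (norm (f x)) (norm (g x))) powr P"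
      using c[of x] P by (intro powr_mono2) auto
    also have "\<dots> = 2 powr P * max (norm (f x)) (norm (g x)) powr P"
      by (simp add: powr_mult)
    also have "\<dots> \<le> 2 powr P * (norm (f x) powr P + norm (g x) powr P)"
      by (intro mult_left_mono) (auto simp: max_def)
    finally show "ennreal (norm (c x) powr P)
        \<le> ennreal (2 powr P) * (ennreal (norm (f x) powr P) + ennreal (norm (g x) powr P))"
      by (simp flip: ennreal_mult ennreal_plus)
  qed
  also have "\<dots> = ennreal (2 powr P) * ((\<integral>\<^sup>+x. ennreal (norm (f x) powr P) \<partial>count_space V)
      + (\<integral>\<^sup>+x. ennreal (norm (g x) powr P) \<partial>count_space V))"
    by (simp add: nn_integral_cmult nn_integral_add)
  also have "\<dots> \<le> ennreal (2 powr P) * (ennreal (F powr P) + ennreal (G powr P))"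
    using False p f g by (intro mult_left_mono add_mono) (auto simp: lp_norm_le_iff P_def)
  also have "\<dots> = ennreal (2 powr P * (F powr P + G powr P))"
    by (simp flip: ennreal_mult ennreal_plus)
  also have "\<dots> \<le> ennreal ((4 * (F + G)) powr P)"
  proof (rule ennreal_leI)
    have "F powr P + G powr P \<le> 2 * (F + G) powr P"
      using powr_mono2[of P F "F + G"] powr_mono2[of P G "F + G"] P f(2) g(2) by simp
    also have "\<dots> \<le> 2 powr P * (F + G) powr P"
      using powr_mono[of 1 P 2] P by (intro mult_right_mono) auto
    finally have "2 powr P * (F powr P + G powr P) \<le> 2 powr P * (2 powr P * (F + G) powr P)"
      by (intro mult_left_mono) auto
    also have "\<dots> = (4 * (F + G)) powr P"
      by (simp add: powr_mult flip: mult.assoc) (simp flip: powr_mult)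
    finally show "2 powr P * (F powr P + G powr P) \<le> (4 * (F + G)) powr P" .
  qed
  finally show ?thesis
    using lp_norm_le_iff[OF p False, of "4 * (F + G)" V c] f(2) g(2) by (simp add: P_def)
qed

text \<open>Both directions of the comparison are used: embedding (\<open>recip p \<le> recip q\<close>) and
  Hoelder's inequality on a finite set.\<close>
lemma lp_norm_change_exponent:
  assumes p: "1 \<le> p" and q: "1 \<le> q" and c: "lp_norm V q c \<le> ennreal K" "K \<ge> 0"
    and S: "finite S" "S \<subseteq> V" "real (card S) \<le> M" "1 \<le> M" "\<And>x. x \<in> V - S \<Longrightarrow> c x = 0"
  shows "lp_norm V p c \<le> ennreal (2 * M powr max 0 (recip p - recip q) * K)"
proof -
  have bd: "norm (c x) \<le> K" if "x \<in> V" for x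
    using norm_le_lp_norm[OF q c that] .
  show ?thesis
  \<comment> \<open>For \<open>K = 0\<close> the level \<open>L\<close> used below would be 0, so
    this case is treated apart.\<close>
  proof (cases "K = 0")
    case True
    with bd have c0: "c x = 0" if "x \<in> V" for x using that by fastforce
    have "lp_norm V p c \<le> ennreal 0"
    proof (cases "p = \<infinity>")
      case True
      then show ?thesis using c0 lp_norm_top_le_iff[of 0 V c] by simp
    next
      case False
      have "(\<integral>\<^sup>+x. ennreal (norm (c x) powr enn2real p) \<partial>count_space V) = 0"
        using c0 by (subst nn_integral_cong[of _ _ "\<lambda>_. 0"]) auto
      then show ?thesis using lp_norm_le_iff[OF p False, of 0 V c] by simp
    qed
    then show ?thesis using \<open>K = 0\<close> by simp
  next
    case False
    with c have K: "K > 0" by simp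
    show ?thesis
    proof (cases "p = \<infinity>")
      case True
      have "max 0 (recip p - recip q) = 0" using True recip_bounds[OF q] by simp
      moreover have "norm (c x) \<le> 2 * K" if "x \<in> V" for x using bd[OF that] K by simp
      ultimately show ?thesis using True K S(4) by (simp add: lp_norm_top_le_iff)
    next
      case pf: False
      define P where "P = enn2real p"
      have P: "P \<ge> 1" using enn2real_ge_1[OF p pf] by (simp add: P_def)
      have rp: "recip p = 1 / P" using recip_finite[OF p pf] by (simp add: P_def)
      have *: "(\<integral>\<^sup>+x. ennreal (norm (c x) powr P) \<partial>count_space V)
            \<le> ennreal ((2 * M powr max 0 (recip p - recip q) * K) powr P)"
      proof (cases "recip p \<le> recip q")
        case True
        with rp P have "recip q > 0" by (smt (verit) divide_pos_pos)
        then have qf: "q \<noteq> \<infinity>" by auto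
        define Q where "Q = enn2real q"
        have Q: "Q \<ge> 1" using enn2real_ge_1[OF q qf] by (simp add: Q_def)
        have "1 / P \<le> 1 / Q" using True rp recip_finite[OF q qf] by (simp add: Q_def)
        with P Q have "Q \<le> P" by (simp add: field_simps)
        have "(\<integral>\<^sup>+x. ennreal (norm (c x) powr P) \<partial>count_space V)
            \<le> (\<integral>\<^sup>+x. ennreal (K powr (P - Q)) * ennreal (norm (c x) powr Q) \<partial>count_space V)"
        proof (intro nn_integral_mono)
          fix x assume "x \<in> space (count_space V)"
          then have "norm (c x) \<le> K" using bd by simp
          then have "norm (c x) powr (P - Q) * norm (c x) powr Q \<le> K powr (P - Q) * norm (c x) powr Q"
            using \<open>Q \<le> P\<close> by (intro mult_right_mono powr_mono2) auto
          then show "ennreal (norm (c x) powr P) \<le> ennreal (K powr (P - Q)) * ennreal (norm (c x) powr Q)"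
            by (simp flip: ennreal_mult powr_add)
        qed
        also have "\<dots> = ennreal (K powr (P - Q)) * (\<integral>\<^sup>+x. ennreal (norm (c x) powr Q) \<partial>count_space V)"
          by (simp add: nn_integral_cmult)
        also have "\<dots> \<le> ennreal (K powr (P - Q)) * ennreal (K powr Q)"
          using c q qf by (intro mult_left_mono) (auto simp: lp_norm_le_iff Q_def)
        also have "\<dots> = ennreal (K powr P)"
          by (simp flip: ennreal_mult powr_add)
        also have "\<dots> \<le> ennreal ((2 * M powr max 0 (recip p - recip q) * K) powr P)"
          using True S(4) K P by (intro ennreal_leI powr_mono2) auto
        finally show ?thesis .
      next
        case False
        \<comment> \<open>Splitting at a level in place of Hoelder's inequality. Entries up to
          \<open>L\<close> occupy at most M points and give at most M L^P; for larger ones |c|^P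
          \<le> L^(P-Q) |c|^Q, and this choice of \<open>L\<close> makes the resulting bound L^(P-Q)
          K^Q equal to M L^P as well.\<close>
        define L where "L = K * M powr (- recip q)"
        have L: "L > 0" using K S(4) by (simp add: L_def)
        have "(\<integral>\<^sup>+x. ennreal (norm (c x) powr P) \<partial>count_space V)
            = (\<integral>\<^sup>+x. ennreal (norm (c x) powr P) * indicator S x \<partial>count_space V)"
          using S(5) by (intro nn_integral_cong) (auto split: split_indicator)
        also have "\<dots> \<le> ennreal (2 * M * L powr P)"
        proof (cases "q = \<infinity>")
          case True
          then have "L = K" using S(4) by (simp add: L_def)
          have "(\<integral>\<^sup>+x. ennreal (norm (c x) powr P) * indicator S x \<partial>count_space V)
             \<le> (\<integral>\<^sup>+x. ennreal (K powr P) * indicator S x \<partial>count_space V)"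
            using bd P by (intro nn_integral_mono mult_right_mono ennreal_leI powr_mono2) auto
          also have "\<dots> = ennreal (K powr P) * of_nat (card S)"
            using S by (simp add: nn_integral_cmult)
          also have "\<dots> = ennreal (real (card S) * K powr P)"
            by (simp add: ennreal_mult ennreal_of_nat_eq_real_of_nat mult.commute)
          also have "\<dots> \<le> ennreal (2 * M * L powr P)"
            unfolding \<open>L = K\<close> using S(3,4) by (intro ennreal_leI mult_right_mono) auto
          finally show ?thesis .
        next
          case qf: False
          define Q where "Q = enn2real q"
          have Q: "Q \<ge> 1" using enn2real_ge_1[OF q qf] by (simp add: Q_def)
          have rq: "recip q = 1 / Q" using recip_finite[OF q qf] by (simp add: Q_def)
          have "P \<le> Q" using False rp rq P Q by (simp add: field_simps)
          have LQ: "L powr (P - Q) * K powr Q = M * L powr P"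
          proof -
            have "L powr Q = K powr Q / M"
            proof -
              have "(M powr - (1 / Q)) powr Q = M powr - 1"
                unfolding powr_powr using Q by simp
              then show ?thesis
                using K S(4) unfolding L_def rq by (simp add: powr_mult powr_minus divide_inverse)
            qed
            then have "K powr Q = M * L powr Q" using S(4) by simp
            then show ?thesis by (simp add: powr_diff L less_imp_neq[symmetric])
          qed
          have "(\<integral>\<^sup>+x. ennreal (norm (c x) powr P) * indicator S x \<partial>count_space V)
             \<le> (\<integral>\<^sup>+x. ennreal (L powr P) * indicator S x 
                 + ennreal (L powr (P - Q)) * ennreal (norm (c x) powr Q) \<partial>count_space V)"
          proof (intro nn_integral_mono)
            fix x
            have "norm (c x) powr P \<le> L powr P + L powr (P - Q) * norm (c x) powr Q"
            proof (cases "norm (c x) \<le> L")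
              case True
              then have "norm (c x) powr P \<le> L powr P" using P by (intro powr_mono2) auto
              then show ?thesis by (smt (verit) mult_nonneg_nonneg powr_ge_zero)
            next
              case False
              have "norm (c x) powr P = norm (c x) powr (P - Q) * norm (c x) powr Q"
                by (simp flip: powr_add)
              also have "\<dots> \<le> L powr (P - Q) * norm (c x) powr Q"
                using False L \<open>P \<le> Q\<close> by (intro mult_right_mono powr_mono2') auto
              finally show ?thesis by (smt (verit) powr_ge_zero)
            qed
            then show "ennreal (norm (c x) powr P) * indicator S x \<le> ennreal (L powr P) * indicator S x 
                 + ennreal (L powr (P - Q)) * ennreal (norm (c x) powr Q)"
              by (auto split: split_indicator simp flip: ennreal_mult ennreal_plus)
          qed
          also have "\<dots> = ennreal (L powr P) * of_nat (card S)
              + ennreal (L powr (P - Q)) * (\<integral>\<^sup>+x. ennreal (norm (c x) powr Q) \<partial>count_space V)"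
            using S by (simp add: nn_integral_add nn_integral_cmult)
          also have "\<dots> \<le> ennreal (L powr P) * ennreal M + ennreal (L powr (P - Q)) * ennreal (K powr Q)"
            using c q qf S 
            by (intro mult_left_mono add_mono) 
              (auto simp: lp_norm_le_iff Q_def ennreal_of_nat_eq_real_of_nat intro: ennreal_leI)
          also have "\<dots> = ennreal (2 * M * L powr P)"
            using S(4) LQ by (simp add: mult.commute flip: ennreal_mult ennreal_plus)
          finally show ?thesis .
        qed
        also have "\<dots> \<le> ennreal ((2 * M powr max 0 (recip p - recip q) * K) powr P)"
        proof (rule ennreal_leI)
          have "2 * M * L powr P \<le> 2 powr P * M * L powr P"
            using P S(4) powr_mono[of 1 P 2] by (intro mult_right_mono) auto
          also have "\<dots> = (2 * M powr (recip p - recip q) * K) powr P"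
          proof -
            have "(recip p - recip q) * P = 1 + - recip q * P"
              using P rp by (simp add: left_diff_distrib)
            then have "M powr ((recip p - recip q) * P) = M * M powr (- recip q * P)"
              using S(4) by (simp only: powr_add) simp
            then show ?thesis
              using K S(4) unfolding L_def by (simp add: powr_mult powr_powr)
          qed
          finally show "2 * M * L powr P \<le> (2 * M powr max 0 (recip p - recip q) * K) powr P"
            using False by (simp add: max_def)
        qed
        finally show ?thesis .
      qed
      then show ?thesis using pf p K by (simp add: lp_norm_le_iff P_def)
    qed
  qed
qed

subsection \<open>Averaging over balls in doubling spaces\<close>

text \<open>Schur's test; symmetry turns the row bound into a column bound. For finite
  \<open>p\<close>, splitting |f| at a suitable level gives |g x|^P \<le> 2^P \<kappa>^(P-1) times
  the sum of G x y |f y|^P over y, and summing over x with the order interchanged uses the column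
  bound. The factor 2 is uniform in \<open>p\<close>.\<close>

lemma lp_norm_schur:
  fixes G :: "'a \<Rightarrow> 'a \<Rightarrow> real"
  assumes p: "1 \<le> p" and G0: "\<And>x y. G x y \<ge> 0"
    and sym: "\<And>x y. x \<in> V \<Longrightarrow> y \<in> V \<Longrightarrow> G x y = G y x"
    and row: "\<And>x. x \<in> V \<Longrightarrow> (\<integral>\<^sup>+y. ennreal (G x y) \<partial>count_space V) \<le> ennreal \<kappa>" and \<kappa>: "\<kappa> > 0"
    and f: "lp_norm V p f \<le> ennreal K" "K \<ge> 0"
    and g: "\<And>x. x \<in> V \<Longrightarrow> ennreal (norm (g x)) \<le> (\<integral>\<^sup>+y. ennreal (G x y * norm (f y)) \<partial>count_space V)"
  shows "lp_norm V p g \<le> ennreal (2 * \<kappa> * K)"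
proof -
  have bd: "norm (f y) \<le> K" if "y \<in> V" for y
    using norm_le_lp_norm[OF p f that] .
  have row_mult: "(\<integral>\<^sup>+y. ennreal (G x y * h y) \<partial>count_space V) \<le> ennreal (\<kappa> * M)"
    if "x \<in> V" "M \<ge> 0" "\<And>y. y \<in> V \<Longrightarrow> h y \<le> M" for x M h
  proof -
    have "(\<integral>\<^sup>+y. ennreal (G x y * h y) \<partial>count_space V)
        \<le> (\<integral>\<^sup>+y. ennreal (G x y) * ennreal M \<partial>count_space V)"
      using that G0 by (intro nn_integral_mono) (auto simp flip: ennreal_mult intro!: ennreal_leI mult_left_mono)
    also have "\<dots> = (\<integral>\<^sup>+y. ennreal (G x y) \<partial>count_space V) * ennreal M"
      by (simp add: nn_integral_multc)
    also have "\<dots> \<le> ennreal \<kappa> * ennreal M"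
      using row that by (intro mult_right_mono) auto
    finally show ?thesis using that \<kappa> by (simp flip: ennreal_mult)
  qed
  show ?thesis
  proof (cases "p = \<infinity>")
    case True
    have "norm (g x) \<le> 2 * \<kappa> * K" if "x \<in> V" for x
    proof -
      have "ennreal (norm (g x)) \<le> ennreal (\<kappa> * K)"
        using g[OF that] row_mult[OF that f(2), of "\<lambda>y. norm (f y)"] bd by (auto intro: order_trans)
      then have "norm (g x) \<le> \<kappa> * K" using \<kappa> f(2) by (simp add: ennreal_le_iff)
      moreover have "0 \<le> \<kappa> * K" using \<kappa> f(2) by simp
      ultimately show ?thesis by linarith
    qed
    then show ?thesis
      using True \<kappa> f(2) lp_norm_top_le_iff[of "2 * \<kappa> * K" V g] by simp
  next
    case False
    define P where "P = enn2real p"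
    have P: "P \<ge> 1" using enn2real_ge_1[OF p False] by (simp add: P_def)
    define T where "T x = (\<integral>\<^sup>+y. ennreal (G x y * norm (f y) powr P) \<partial>count_space V)" for x
    have gT: "ennreal (norm (g x) powr P) \<le> ennreal (2 powr P * \<kappa> powr (P - 1)) * T x"
      if x: "x \<in> V" for x
    proof -
      have "T x \<le> ennreal (\<kappa> * K powr P)"
        unfolding T_def using bd P f(2) by (intro row_mult[OF x]) (auto intro: powr_mono2)
      then obtain t where t: "T x = ennreal t" "t \<ge> 0"
        by (cases "T x" rule: ennreal_cases) (auto simp: top_unique)
      have split: "norm (g x) \<le> \<kappa> * l + l powr (1 - P) * t" if l: "l > 0" for l
      proof -
        have pt: "u \<le> l + l powr (1 - P) * u powr P" if "u \<ge> 0" for u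
        proof (cases "u \<le> l")
          case True
          then show ?thesis using l by (smt (verit) mult_nonneg_nonneg powr_ge_zero)
        next
          case False
          have "u = u powr (1 - P) * u powr P" using False l by (simp flip: powr_add)
          also have "\<dots> \<le> l powr (1 - P) * u powr P"
            using False l P by (intro mult_right_mono powr_mono2') auto
          finally show ?thesis using l by simp
        qed
        have "ennreal (norm (g x)) \<le> (\<integral>\<^sup>+y. ennreal (G x y * norm (f y)) \<partial>count_space V)"
          using g[OF x] .
        also have "\<dots> \<le> (\<integral>\<^sup>+y. ennreal l * ennreal (G x y)
            + ennreal (l powr (1 - P)) * ennreal (G x y * norm (f y) powr P) \<partial>count_space V)"
        proof (intro nn_integral_mono)
          fix y
          have "G x y * norm (f y) \<le> G x y * (l + l powr (1 - P) * norm (f y) powr P)"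
            using pt[of "norm (f y)"] G0 by (intro mult_left_mono) auto
          also have "\<dots> = l * G x y + l powr (1 - P) * (G x y * norm (f y) powr P)"
            by (simp add: algebra_simps)
          finally show "ennreal (G x y * norm (f y)) \<le> ennreal l * ennreal (G x y)
            + ennreal (l powr (1 - P)) * ennreal (G x y * norm (f y) powr P)"
            using l G0[of x y] by (simp flip: ennreal_mult ennreal_plus)
        qed
        also have "\<dots> = ennreal l * (\<integral>\<^sup>+y. ennreal (G x y) \<partial>count_space V) + ennreal (l powr (1 - P)) * T x"
          by (simp add: nn_integral_add nn_integral_cmult T_def)
        also have "\<dots> \<le> ennreal l * ennreal \<kappa> + ennreal (l powr (1 - P)) * T x"
          using row[OF x] by (intro add_mono mult_left_mono) auto
        also have "\<dots> = ennreal (\<kappa> * l + l powr (1 - P) * t)"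
          using l \<kappa> t by (simp add: mult.commute flip: ennreal_mult ennreal_plus)
        finally show ?thesis by (rule ennreal_le_iff[THEN iffD1, rotated]) (use l \<kappa> t in simp)
      qed
      have "norm (g x) powr P \<le> 2 powr P * \<kappa> powr (P - 1) * t"
      proof (cases "t = 0")
        case True
        \<comment> \<open>The balancing level would be 0 here; letting \<open>l\<close> tend to 0 in
          \<open>split\<close> serves instead.\<close>
        have "norm (g x) \<le> 0"
        proof (rule field_le_epsilon)
          fix e :: real assume "e > 0"
          then show "norm (g x) \<le> 0 + e" using split[of "e / \<kappa>"] \<kappa> True by simp
        qed
        then show ?thesis using True P by simp
      next
        case False
        with t have t0: "t > 0" by simp
        \<comment> \<open>The level at which the two terms of \<open>split\<close> agree, both being
          \<open>\<kappa> * l\<close>.\<close>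
        define l where "l = (t / \<kappa>) powr (1 / P)"
        have l: "l > 0" using t0 \<kappa> by (simp add: l_def)
        have lP: "l powr P = t / \<kappa>" using t0 \<kappa> P by (simp add: l_def powr_powr)
        have "l powr (1 - P) * t = \<kappa> * l"
          using l \<kappa> lP by (simp add: powr_diff field_simps)
        then have "norm (g x) \<le> 2 * \<kappa> * l" using split[OF l] by simp
        then have "norm (g x) powr P \<le> (2 * \<kappa> * l) powr P" using P by (intro powr_mono2) auto
        also have "\<dots> = 2 powr P * \<kappa> powr P * (t / \<kappa>)" using \<kappa> l lP by (simp add: powr_mult)
        also have "\<dots> = 2 powr P * \<kappa> powr (P - 1) * t" using \<kappa> by (simp add: powr_diff)
        finally show ?thesis .
      qed
      then show ?thesis using t by (simp flip: ennreal_mult)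
    qed
    have "(\<integral>\<^sup>+x. ennreal (norm (g x) powr P) \<partial>count_space V)
        \<le> (\<integral>\<^sup>+x. ennreal (2 powr P * \<kappa> powr (P - 1)) * T x \<partial>count_space V)"
      using gT by (intro nn_integral_mono) auto
    also have "\<dots> = ennreal (2 powr P * \<kappa> powr (P - 1)) * (\<integral>\<^sup>+x. T x \<partial>count_space V)"
      by (simp add: nn_integral_cmult)
    also have "(\<integral>\<^sup>+x. T x \<partial>count_space V)
        = (\<integral>\<^sup>+y. \<integral>\<^sup>+x. ennreal (G x y * norm (f y) powr P) \<partial>count_space V \<partial>count_space V)"
      unfolding T_def by (rule nn_integral_count_space_commute)
    also have "\<dots> \<le> (\<integral>\<^sup>+y. ennreal \<kappa> * ennreal (norm (f y) powr P) \<partial>count_space V)"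
    proof (intro nn_integral_mono)
      fix y assume "y \<in> space (count_space V)"
      then have y: "y \<in> V" by simp
      have "(\<integral>\<^sup>+x. ennreal (G x y * norm (f y) powr P) \<partial>count_space V)
          = (\<integral>\<^sup>+x. ennreal (G y x) * ennreal (norm (f y) powr P) \<partial>count_space V)"
        using y sym G0 by (intro nn_integral_cong) (auto simp: ennreal_mult)
      also have "\<dots> = (\<integral>\<^sup>+x. ennreal (G y x) \<partial>count_space V) * ennreal (norm (f y) powr P)"
        by (simp add: nn_integral_multc)
      also have "\<dots> \<le> ennreal \<kappa> * ennreal (norm (f y) powr P)"
        using row[OF y] by (intro mult_right_mono) auto
      finally show "(\<integral>\<^sup>+x. ennreal (G x y * norm (f y) powr P) \<partial>count_space V)
          \<le> ennreal \<kappa> * ennreal (norm (f y) powr P)" .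
    qed
    also have "\<dots> = ennreal \<kappa> * (\<integral>\<^sup>+y. ennreal (norm (f y) powr P) \<partial>count_space V)"
      by (simp add: nn_integral_cmult)
    also have "\<dots> \<le> ennreal \<kappa> * ennreal (K powr P)"
      using f False p by (intro mult_left_mono) (auto simp: lp_norm_le_iff P_def)
    finally have "(\<integral>\<^sup>+x. ennreal (norm (g x) powr P) \<partial>count_space V)
        \<le> ennreal (2 powr P * \<kappa> powr (P - 1)) * (ennreal \<kappa> * ennreal (K powr P))"
      by (simp add: mult_left_mono)
    also have "\<dots> = ennreal (2 powr P * \<kappa> powr (P - 1) * (\<kappa> * K powr P))"
      using \<kappa> by (simp flip: ennreal_mult)
    also have "2 powr P * \<kappa> powr (P - 1) * (\<kappa> * K powr P) = (2 * \<kappa> * K) powr P"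
      using \<kappa> f(2) by (simp add: powr_mult powr_diff)
    finally show ?thesis
      using lp_norm_le_iff[OF p False, of "2 * \<kappa> * K" V g] \<kappa> f(2) by (simp add: P_def)
  qed
qed

text \<open>Graph-free setting: an integer-valued distance with balls measured by cardinality. Both
  constants are normalised to be at least 1, so that expressions such as
  \<open>D1 * 5 powr d\<close> dominate their own powers with exponent in [0, 1] and a factor
  \<open>D0 ^ 4\<close> can be inserted freely.\<close>

locale doubling_space =
  fixes V :: "'a set" and \<rho> :: "'a \<Rightarrow> 'a \<Rightarrow> nat" and bl :: "'a \<Rightarrow> real \<Rightarrow> 'a set" and D0 D1 d :: real
  defines "bl x R \<equiv> {y \<in> V. real (\<rho> x y) \<le> R}"
  assumes dist_refl: "x \<in> V \<Longrightarrow> \<rho> x x = 0"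
    and dist_sym: "x \<in> V \<Longrightarrow> y \<in> V \<Longrightarrow> \<rho> x y = \<rho> y x"
    and dist_triangle: "x \<in> V \<Longrightarrow> y \<in> V \<Longrightarrow> z \<in> V \<Longrightarrow> \<rho> x z \<le> \<rho> x y + \<rho> y z"
    and finite_bl: "x \<in> V \<Longrightarrow> finite (bl x R)"
    and growth: "x \<in> V \<Longrightarrow> R \<ge> 0 \<Longrightarrow> real (card (bl x R)) \<le> D1 * (R + 1) powr d"
    and doubling: "x \<in> V \<Longrightarrow> R \<ge> 0 \<Longrightarrow> real (card (bl x (2 * R))) \<le> D0 * real (card (bl x R))"
    and D0: "D0 \<ge> 1" and D1: "D1 \<ge> 1" and d: "d > 0"
begin

lemma bl_subset: "bl x R \<subseteq> V"
  by (auto simp: bl_def)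

lemma card_bl_pos: "x \<in> V \<Longrightarrow> R \<ge> 0 \<Longrightarrow> card (bl x R) > 0"
  using finite_bl[of x R] by (auto simp: card_gt_0_iff bl_def dist_refl)

lemma bl_sym: "x \<in> V \<Longrightarrow> y \<in> bl x R \<Longrightarrow> x \<in> bl y R"
  by (auto simp: bl_def dist_sym)

lemma bl_trans: "x \<in> V \<Longrightarrow> y \<in> bl x R \<Longrightarrow> bl y S \<subseteq> bl x (R + S)"
proof
  fix z assume h: "x \<in> V" "y \<in> bl x R" "z \<in> bl y S"
  then have "\<rho> x z \<le> \<rho> x y + \<rho> y z" by (intro dist_triangle) (auto simp: bl_def)
  then have "real (\<rho> x z) \<le> real (\<rho> x y) + real (\<rho> y z)" by linarith
  with h show "z \<in> bl x (R + S)" by (auto simp: bl_def)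
qed

text \<open>For m in \<open>bl x N\<close> the ball \<open>bl m N\<close> lies in
  \<open>bl x (2 * N)\<close>, so m has weight at least 1 / card (bl x (2 * N)); there are card (bl
  x N) such m, and doubling compares the two cardinalities.\<close>

lemma ball_weights_lower:
  assumes x: "x \<in> V" and N: "N \<ge> 0"
  shows "1 \<le> ennreal D0 * (\<integral>\<^sup>+m. ennreal (1 / real (card (bl m N))) * indicator (bl m N) x \<partial>count_space V)"
proof -
  have "1 \<le> ennreal D0 * (ennreal (1 / real (card (bl x (2 * N)))) * of_nat (card (bl x N)))"
  proof -
    define a where "a = 1 / real (card (bl x (2 * N)))"
    have "1 \<le> D0 * (a * real (card (bl x N)))"
      unfolding a_def using doubling[OF x N] card_bl_pos[OF x, of "2 * N"] N by (simp add: field_simps)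
    then have "ennreal 1 \<le> ennreal (D0 * (a * real (card (bl x N))))"
      by (rule ennreal_leI)
    moreover have "a \<ge> 0" by (simp add: a_def)
    ultimately show ?thesis
      unfolding a_def[symmetric] using D0 by (simp add: ennreal_mult ennreal_of_nat_eq_real_of_nat)
  qed
  also have "ennreal (1 / real (card (bl x (2 * N)))) * of_nat (card (bl x N))
     = (\<integral>\<^sup>+m. ennreal (1 / real (card (bl x (2 * N)))) * indicator (bl x N) m \<partial>count_space V)"
    using bl_subset finite_bl[OF x] by (subst nn_integral_cmult_indicator) auto
  also have "\<dots> \<le> (\<integral>\<^sup>+m. ennreal (1 / real (card (bl m N))) * indicator (bl m N) x \<partial>count_space V)"
  proof (intro nn_integral_mono)
    fix m
    show "ennreal (1 / real (card (bl x (2 * N)))) * indicator (bl x N) m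
       \<le> ennreal (1 / real (card (bl m N))) * indicator (bl m N) x"
    proof (cases "m \<in> bl x N")
      case True
      then have m: "m \<in> V" using bl_subset by auto
      have "bl m N \<subseteq> bl x (2 * N)" using bl_trans[OF x True, of N] by simp
      then have "card (bl m N) \<le> card (bl x (2 * N))" using finite_bl[OF x] by (intro card_mono)
      then have "1 / real (card (bl x (2 * N))) \<le> 1 / real (card (bl m N))"
        using card_bl_pos[OF m N] by (intro divide_left_mono) auto
      then show ?thesis using True bl_sym[OF x True] by (simp add: ennreal_leI)
    qed simp
  qed
  finally show ?thesis by (simp add: mult_left_mono)
qed

text \<open>The contributing m lie in \<open>bl x (4 * N)\<close>, and this ball lies in
  \<open>bl m (8 * N)\<close>; three doublings, 8 being 2^3, bound the weight of m by D0^3 / card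
  (bl x (4 * N)).\<close>

lemma ball_weights_upper:
  assumes x: "x \<in> V" and N: "N \<ge> 0"
  shows "(\<integral>\<^sup>+m. ennreal (1 / real (card (bl m N))) * indicator (bl m (4 * N)) x \<partial>count_space V) \<le> ennreal (D0 ^ 3)"
proof -
  have "(\<integral>\<^sup>+m. ennreal (1 / real (card (bl m N))) * indicator (bl m (4 * N)) x \<partial>count_space V)
     \<le> (\<integral>\<^sup>+m. ennreal (D0 ^ 3 / real (card (bl x (4 * N)))) * indicator (bl x (4 * N)) m \<partial>count_space V)"
  proof (intro nn_integral_mono)
    fix m assume "m \<in> space (count_space V)"
    then have m: "m \<in> V" by simp
    show "ennreal (1 / real (card (bl m N))) * indicator (bl m (4 * N)) x
       \<le> ennreal (D0 ^ 3 / real (card (bl x (4 * N)))) * indicator (bl x (4 * N)) m"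
    proof (cases "x \<in> bl m (4 * N)")
      case True
      have "bl x (4 * N) \<subseteq> bl m (2 * (2 * (2 * N)))" using bl_trans[OF m True, of "4 * N"] by simp
      then have "real (card (bl x (4 * N))) \<le> real (card (bl m (2 * (2 * (2 * N)))))"
        using finite_bl[OF m] by (auto intro: card_mono)
      also have "\<dots> \<le> D0 * real (card (bl m (2 * (2 * N))))" using N by (intro doubling[OF m]) auto
      also have "\<dots> \<le> D0 * (D0 * real (card (bl m (2 * N))))"
        using N D0 by (intro mult_left_mono doubling[OF m]) auto
      also have "\<dots> \<le> D0 * (D0 * (D0 * real (card (bl m N))))"
        using N D0 by (intro mult_left_mono doubling[OF m]) auto
      finally have "1 / real (card (bl m N)) \<le> D0 ^ 3 / real (card (bl x (4 * N)))"
        using card_bl_pos[OF m N] card_bl_pos[OF x, of "4 * N"] N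
        by (simp add: divide_simps power3_eq_cube mult.assoc)
      then show ?thesis using True bl_sym[OF m True] by (simp add: ennreal_leI)
    qed simp
  qed
  also have "\<dots> = ennreal (D0 ^ 3 / real (card (bl x (4 * N)))) * of_nat (card (bl x (4 * N)))"
    using bl_subset finite_bl[OF x] by (subst nn_integral_cmult_indicator) auto
  also have "\<dots> = ennreal (D0 ^ 3 / real (card (bl x (4 * N))) * real (card (bl x (4 * N))))"
    using D0 by (subst ennreal_mult) (simp_all add: ennreal_of_nat_eq_real_of_nat)
  also have "\<dots> = ennreal (D0 ^ 3)"
    by (rule arg_cong[where f = ennreal]) (use card_bl_pos[OF x, of "4 * N"] N in simp)
  finally show ?thesis .
qed

text \<open>Averaging the local estimates over all centres \<open>m\<close> with the weights \<open>1 / card (bl m N)\<close>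
  replaces the choice of a maximal separated set of centres.\<close>
lemma lp_norm_local_to_global:
  assumes q: "1 \<le> q" and N: "N \<ge> 0" and K: "K \<ge> 0" and f: "lp_norm V q f \<le> ennreal F0" "F0 \<ge> 0"
    and loc: "\<And>m F. m \<in> V \<Longrightarrow> F \<ge> 0 \<Longrightarrow>
      lp_norm V q (\<lambda>x. if x \<in> bl m (4 * N) then f x else 0) \<le> ennreal F \<Longrightarrow>
      lp_norm V q (\<lambda>x. if x \<in> bl m N then c x else 0) \<le> ennreal (K * F)"
  shows "lp_norm V q c \<le> ennreal (D0 ^ 4 * K * F0)"
proof (cases "q = \<infinity>")
  case True
  \<comment> \<open>No averaging for \<open>q = \<infinity>\<close>: the local estimate on the ball
    centred at x already bounds c x.\<close>
  have "norm (c x) \<le> D0 ^ 4 * K * F0" if x: "x \<in> V" for x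
  proof -
    have "lp_norm V q (\<lambda>y. if y \<in> bl x (4 * N) then f y else 0) \<le> lp_norm V q f"
      using q by (intro lp_norm_mono) auto
    then have "lp_norm V q (\<lambda>y. if y \<in> bl x N then c y else 0) \<le> ennreal (K * F0)"
      using f by (intro loc[OF x]) auto
    from norm_le_lp_norm[OF q this _ x] have "norm (c x) \<le> K * F0"
      using x N K f(2) by (simp add: bl_def dist_refl)
    also have "\<dots> \<le> D0 ^ 4 * (K * F0)"
      using D0 K f(2) mult_right_mono[of 1 "D0 ^ 4" "K * F0"] one_le_power[of D0 4] by simp
    finally show ?thesis by (simp add: mult.assoc)
  qed
  then show ?thesis
    using True K f(2) D0 lp_norm_top_le_iff[of "D0 ^ 4 * K * F0" V c] by simp
next
  case False
  define Q where "Q = enn2real q"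
  have Q: "Q \<ge> 1" using enn2real_ge_1[OF q False] by (simp add: Q_def)
  define w where "w m = ennreal (1 / real (card (bl m N)))" for m
  define I where "I g R m = (\<integral>\<^sup>+x. ennreal (norm (g x) powr Q) * indicator (bl m R) x \<partial>count_space V)"
    for g :: "'a \<Rightarrow> complex" and R m
  have trunc: "lp_norm V q (\<lambda>x. if x \<in> bl m R then g x else 0) \<le> ennreal F \<longleftrightarrow> I g R m \<le> ennreal (F powr Q)"
    if "F \<ge> 0" for F m R and g :: "'a \<Rightarrow> complex"
  proof -
    have "(\<integral>\<^sup>+x. ennreal (norm (if x \<in> bl m R then g x else 0) powr Q) \<partial>count_space V) = I g R m"
      unfolding I_def by (intro nn_integral_cong) (auto split: split_indicator)
    then show ?thesis
      using lp_norm_le_iff[OF q False that, of V "\<lambda>x. if x \<in> bl m R then g x else 0", folded Q_def]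
      by (simp only:)
  qed
  have f': "(\<integral>\<^sup>+x. ennreal (norm (f x) powr Q) \<partial>count_space V) \<le> ennreal (F0 powr Q)"
    using f(1) lp_norm_le_iff[OF q False f(2), of V f] by (simp add: Q_def)
  have loc': "I c N m \<le> ennreal (K powr Q) * I f (4 * N) m" if m: "m \<in> V" for m
  proof -
    have "I f (4 * N) m \<le> (\<integral>\<^sup>+x. ennreal (norm (f x) powr Q) \<partial>count_space V)"
      unfolding I_def by (intro nn_integral_mono) (auto split: split_indicator)
    with f' have "I f (4 * N) m \<le> ennreal (F0 powr Q)" by simp
    then obtain t where t: "I f (4 * N) m = ennreal t" "t \<ge> 0"
      by (cases "I f (4 * N) m" rule: ennreal_cases) (auto simp: top_unique)
    \<comment> \<open>The exact local norm of f; \<open>loc\<close> is assumed for every bound F so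
      that it can be used with this one.\<close>
    define F where "F = t powr (1 / Q)"
    have F: "F \<ge> 0" "F powr Q = t" using t Q by (auto simp: F_def powr_powr)
    have "lp_norm V q (\<lambda>x. if x \<in> bl m (4 * N) then f x else 0) \<le> ennreal F"
      using trunc[OF F(1)] t F by simp
    from loc[OF m F(1) this] have "I c N m \<le> ennreal ((K * F) powr Q)"
      using trunc[of "K * F"] K F by simp
    then show ?thesis using t F K by (simp add: powr_mult flip: ennreal_mult)
  qed
  \<comment> \<open>Inserting the weights costs \<open>D0\<close>, removing them after the local
    bound costs \<open>D0 ^ 3\<close>; together they give the fourth power.\<close>
  have "(\<integral>\<^sup>+x. ennreal (norm (c x) powr Q) \<partial>count_space V)
     \<le> (\<integral>\<^sup>+x. ennreal (norm (c x) powr Q) * (ennreal D0 * (\<integral>\<^sup>+m. w m * indicator (bl m N) x \<partial>count_space V)) \<partial>count_space V)"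
    using mult_left_mono[OF ball_weights_lower[OF _ N]] unfolding w_def
    by (intro nn_integral_mono) fastforce
  also have "\<dots> = ennreal D0 * (\<integral>\<^sup>+x. \<integral>\<^sup>+m. ennreal (norm (c x) powr Q) * (w m * indicator (bl m N) x) \<partial>count_space V \<partial>count_space V)"
    by (simp add: nn_integral_cmult mult.left_commute[of _ "ennreal D0"])
  also have "(\<integral>\<^sup>+x. \<integral>\<^sup>+m. ennreal (norm (c x) powr Q) * (w m * indicator (bl m N) x) \<partial>count_space V \<partial>count_space V)
     = (\<integral>\<^sup>+m. \<integral>\<^sup>+x. ennreal (norm (c x) powr Q) * (w m * indicator (bl m N) x) \<partial>count_space V \<partial>count_space V)"
    by (rule nn_integral_count_space_commute)
  also have "\<dots> = (\<integral>\<^sup>+m. w m * I c N m \<partial>count_space V)"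
    unfolding I_def by (simp add: mult.left_commute[of _ "w _"] nn_integral_cmult)
  also have "\<dots> \<le> (\<integral>\<^sup>+m. w m * (ennreal (K powr Q) * I f (4 * N) m) \<partial>count_space V)"
    using loc' by (intro nn_integral_mono mult_left_mono) auto
  also have "\<dots> = ennreal (K powr Q) * (\<integral>\<^sup>+m. w m * I f (4 * N) m \<partial>count_space V)"
    by (simp add: nn_integral_cmult mult.left_commute[of "w _"])
  also have "(\<integral>\<^sup>+m. w m * I f (4 * N) m \<partial>count_space V)
     = (\<integral>\<^sup>+m. \<integral>\<^sup>+x. ennreal (norm (f x) powr Q) * (w m * indicator (bl m (4 * N)) x) \<partial>count_space V \<partial>count_space V)"
    unfolding I_def by (simp add: mult.left_commute[of _ "w _"] nn_integral_cmult)
  also have "\<dots> = (\<integral>\<^sup>+x. \<integral>\<^sup>+m. ennreal (norm (f x) powr Q) * (w m * indicator (bl m (4 * N)) x) \<partial>count_space V \<partial>count_space V)"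
    by (rule nn_integral_count_space_commute)
  also have "\<dots> \<le> (\<integral>\<^sup>+x. ennreal (norm (f x) powr Q) * ennreal (D0 ^ 3) \<partial>count_space V)"
    using ball_weights_upper[OF _ N] unfolding w_def
    by (intro nn_integral_mono) (simp add: nn_integral_cmult mult_left_mono)
  also have "\<dots> = (\<integral>\<^sup>+x. ennreal (norm (f x) powr Q) \<partial>count_space V) * ennreal (D0 ^ 3)"
    by (simp add: nn_integral_multc)
  also have "\<dots> \<le> ennreal (F0 powr Q) * ennreal (D0 ^ 3)"
    using f' by (intro mult_right_mono) auto
  finally have "(\<integral>\<^sup>+x. ennreal (norm (c x) powr Q) \<partial>count_space V)
      \<le> ennreal D0 * (ennreal (K powr Q) * (ennreal (F0 powr Q) * ennreal (D0 ^ 3)))"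
    by (simp add: mult_left_mono)
  also have "\<dots> = ennreal (D0 ^ 4 * (K powr Q * F0 powr Q))"
    using D0 by (simp add: mult_ac power4_eq_xxxx power3_eq_cube flip: ennreal_mult)
  also have "\<dots> \<le> ennreal ((D0 ^ 4 * K * F0) powr Q)"
  proof (rule ennreal_leI)
    \<comment> \<open>A constant at least 1 may be moved under the power Q \<ge> 1; taking the root
      then leaves a constant independent of q.\<close>
    have "D0 ^ 4 \<le> (D0 ^ 4) powr Q"
      using powr_mono[of 1 Q "D0 ^ 4"] Q D0 one_le_power[of D0 4] by simp
    then have "D0 ^ 4 * (K powr Q * F0 powr Q) \<le> (D0 ^ 4) powr Q * (K powr Q * F0 powr Q)"
      by (intro mult_right_mono) auto
    also have "\<dots> = (D0 ^ 4 * K * F0) powr Q" using D0 K f(2) by (simp add: powr_mult)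
    finally show "D0 ^ 4 * (K powr Q * F0 powr Q) \<le> (D0 ^ 4 * K * F0) powr Q" .
  qed
  finally show ?thesis
    using lp_norm_le_iff[OF q False, of "D0 ^ 4 * K * F0" V c] D0 K f(2) by (simp add: Q_def)
qed

end

subsection \<open>Row sums of the truncated kernel\<close>

text \<open>\<open>mat_apply\<close> is an \<open>infsum\<close>, which is 0 by default on a family
  that is not summable. A finite dominating integral gives absolute summability, and only then may
  such sums be split and estimated termwise.\<close>

lemma infsum_norm_le_nn_integral:
  fixes h :: "'a \<Rightarrow> complex"
  assumes "(\<integral>\<^sup>+x. ennreal (norm (h x)) \<partial>count_space A) < \<infinity>"
  shows "h summable_on A"
    and "ennreal (norm (infsum h A)) \<le> (\<integral>\<^sup>+x. ennreal (norm (h x)) \<partial>count_space A)"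
proof -
  have "integrable (count_space A) h"
    using assms by (simp add: integrable_iff_bounded)
  then have abs': "Infinite_Set_Sum.abs_summable_on h A"
    by (simp add: abs_summable_on_def)
  then have abs: "(\<lambda>x. norm (h x)) summable_on A"
    by (rule iffD2[OF abs_summable_equivalent])
  show "h summable_on A" using abs by (rule abs_summable_summable)
  have abs'': "Infinite_Set_Sum.abs_summable_on (\<lambda>x. norm (h x)) A"
    using abs' by (simp add: Infinite_Set_Sum.abs_summable_on_norm_iff)
  have "ennreal (norm (infsum h A)) \<le> ennreal (infsum (\<lambda>x. norm (h x)) A)"
    using norm_infsum_bound[OF abs] by (rule ennreal_leI)
  also have "\<dots> = (\<integral>\<^sup>+x. ennreal (norm (h x)) \<partial>count_space A)"
    using nn_integral_conv_infsetsum[OF abs''] infsetsum_infsum[OF abs''] by simp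
  finally show "ennreal (norm (infsum h A)) \<le> (\<integral>\<^sup>+x. ennreal (norm (h x)) \<partial>count_space A)" .
qed

text \<open>Order of the row sums of the truncated kernel. At s = 1 all dyadic levels up to N
  contribute equally and the logarithm counts them; \<open>1 + ln N\<close> instead of
  \<open>ln N\<close> keeps the rate positive at N = 1.\<close>

definition loss_rate :: "real \<Rightarrow> real \<Rightarrow> real" where
  "loss_rate s N = N powr - min s 1 * (if s = 1 then 1 + ln N else 1)"

lemma dyadic_powr: "((2::real) ^ j) powr a = (2 powr a) ^ j"
  by (simp add: powr_power powr_powr mult.commute flip: powr_realpow)

text \<open>While 2^j \<le> N the terms are 2^(j(1-s)) / N, beyond that they are 2^(-js). The head
  is a geometric sum of ratio 2^(1-s), governed by its first term, its number of terms or its last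
  term according as s > 1, s = 1 or s < 1; the tail is of order N^(-s), never larger than the loss
  rate.\<close>

lemma dyadic_sum_le:
  assumes s: "s > 0"
  shows "\<exists>C>0. \<forall>N\<ge>1. (\<Sum>j. ennreal ((2 ^ j) powr - s * min 1 (2 ^ j / N))) \<le> ennreal (C * loss_rate s N)"
proof -
  define x where "x = (2::real) powr (1 - s)"
  define y where "y = (2::real) powr - s"
  have y: "0 < y" "y < 1" using s by (auto simp: y_def powr_less_one)
  have x: "x > 0" by (simp add: x_def)
  have xs: "(x < 1) = (s > 1)" "(x > 1) = (s < 1)" "(x = 1) = (s = 1)"
    using powr_less_cancel_iff[of 2 "1 - s" 0] powr_less_cancel_iff[of 2 0 "1 - s"]
    by (auto simp: x_def)
  define C where "C = 1 / (1 - y) + (if s > 1 then 1 / (1 - x) else if s = 1 then 1 + 1 / ln 2 else x / (x - 1))"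
  have "C > 0"
  proof -
    have "1 / (1 - y) > 0" using y by simp
    moreover have "(if s > 1 then 1 / (1 - x) else if s = 1 then 1 + 1 / ln 2 else x / (x - 1)) \<ge> 0"
      using x xs by (auto intro!: add_nonneg_nonneg)
    ultimately show ?thesis unfolding C_def by linarith
  qed
  moreover have "(\<Sum>j. ennreal ((2 ^ j) powr - s * min 1 (2 ^ j / N))) \<le> ennreal (C * loss_rate s N)"
    if N: "N \<ge> 1" for N :: real
  proof -
    define a where "a j = (2 ^ j) powr - s * min 1 (2 ^ j / N)" for j :: nat
    have a0: "a j \<ge> 0" for j using N by (simp add: a_def)
    have ay: "a j \<le> y ^ j" for j
      using N mult_left_mono[of "min 1 (2 ^ j / N)" 1 "y ^ j"] y
      by (simp add: a_def y_def[symmetric] dyadic_powr)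
    have ax: "a j \<le> x ^ j / N" for j
    proof -
      have "a j \<le> (2 ^ j) powr - s * (2 ^ j / N)"
        unfolding a_def by (intro mult_left_mono) auto
      also have "(2 ^ j) powr - s * (2 ^ j / N) = (2 ^ j) powr (1 - s) / N"
        by (simp add: powr_diff powr_minus divide_simps)
      finally show ?thesis by (simp add: dyadic_powr x_def)
    qed
    have smy: "summable (\<lambda>j. y ^ j)" using y by simp
    have sm: "summable a"
      using ay a0 by (intro summable_comparison_test'[OF smy, of 0]) auto
    \<comment> \<open>\<open>J\<close> is the dyadic order of \<open>N\<close>; the head consists of
      the indices 0 to J, so that the tail starts at 2^(J+1) > N.\<close>
    obtain J :: nat where J: "2 ^ J \<le> N" "N < 2 ^ (J + 1)"
    proof -
      have "1 \<le> nat \<lfloor>N\<rfloor>" using N by linarith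
      then obtain J where "2 ^ J \<le> nat \<lfloor>N\<rfloor>" "nat \<lfloor>N\<rfloor> < 2 ^ (J + 1)"
        using ex_power_ivl1[of 2 "nat \<lfloor>N\<rfloor>"] by auto
      then have "(2::real) ^ J \<le> real (nat \<lfloor>N\<rfloor>)" "real (nat \<lfloor>N\<rfloor>) + 1 \<le> 2 ^ (J + 1)"
        by (metis numeral_power_le_of_nat_cancel_iff of_nat_numeral, 
            metis Suc_eq_plus1 Suc_leI of_nat_Suc of_nat_le_numeral_power_cancel_iff add.commute)
      then have "2 ^ J \<le> N" "N < 2 ^ (J + 1)" using N by linarith+
      then show thesis using that by blast
    qed
    have tail: "(\<Sum>j. a (j + (J + 1))) \<le> 1 / (1 - y) * N powr - s"
    proof -
      have le: "a (j + (J + 1)) \<le> N powr - s * y ^ j" for j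
      proof -
        have "a (j + (J + 1)) \<le> y ^ (j + (J + 1))" by (rule ay)
        also have "\<dots> = (2 ^ (J + 1)) powr - s * y ^ j"
          unfolding dyadic_powr y_def by (simp add: power_add)
        also have "\<dots> \<le> N powr - s * y ^ j"
          using J N s y by (intro mult_right_mono powr_mono2') auto
        finally show ?thesis .
      qed
      have "(\<Sum>j. a (j + (J + 1))) \<le> (\<Sum>j. N powr - s * y ^ j)"
        using sm smy by (intro suminf_le le summable_mult) (simp_all only: summable_iff_shift)
      also have "\<dots> = 1 / (1 - y) * N powr - s"
        using y by (simp add: suminf_mult suminf_geometric)
      finally show ?thesis .
    qed
    have ls: "N powr - s \<le> loss_rate s N"
    proof -
      have "N powr - s \<le> N powr - min s 1" using N by (intro powr_mono) auto
      also have "\<dots> \<le> loss_rate s N"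
        unfolding loss_rate_def using N
        by (auto intro: mult_left_mono[of 1 _ "N powr - min s 1", simplified])
      finally show ?thesis .
    qed
    have head: "(\<Sum>j<J + 1. a j) \<le>
       (if s > 1 then 1 / (1 - x) else if s = 1 then 1 + 1 / ln 2 else x / (x - 1)) * loss_rate s N"
    proof -
      have h: "(\<Sum>j<J + 1. a j) \<le> (\<Sum>j<J + 1. x ^ j) / N"
        unfolding sum_divide_distrib by (intro sum_mono ax)
      consider "s > 1" | "s = 1" | "s < 1" by linarith
      then show ?thesis
      proof cases
        case 1
        then have "(\<Sum>j<J + 1. x ^ j) \<le> (\<Sum>j. x ^ j)"
          using x xs by (intro sum_le_suminf) auto
        also have "\<dots> = 1 / (1 - x)" using x xs 1 by (simp add: suminf_geometric)
        finally have "(\<Sum>j<J + 1. a j) \<le> 1 / (1 - x) / N"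
          using h N by (smt (verit) divide_right_mono)
        then show ?thesis using 1 N by (simp add: loss_rate_def powr_minus divide_inverse)
      next
        case 2
        then have "x = 1" using xs by simp
        then have h': "(\<Sum>j<J + 1. a j) \<le> (1 + real J) / N" using h by simp
        have "ln (2 ^ J) \<le> ln N" using J N by (subst ln_le_cancel_iff) auto
        then have "real J \<le> ln N / ln 2" by (simp add: ln_realpow field_simps)
        also have "\<dots> \<le> (1 + 1 / ln 2) * (1 + ln N) - 1"
          using N by (simp add: field_simps)
        finally have "(1 + real J) / N \<le> (1 + 1 / ln 2) * (1 + ln N) / N"
          using N by (intro divide_right_mono) auto
        with h' have "(\<Sum>j<J + 1. a j) \<le> (1 + 1 / ln 2) * (1 + ln N) / N" by (rule order_trans)
        also have "\<dots> = (1 + 1 / ln 2) * loss_rate s N"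
          using 2 N by (simp add: loss_rate_def powr_minus divide_inverse mult_ac)
        finally show ?thesis using 2 by simp
      next
        case 3
        then have x1: "x > 1" using xs by simp
        have "(\<Sum>j<J + 1. x ^ j) = (x ^ (J + 1) - 1) / (x - 1)"
          using x1 by (subst geometric_sum) auto
        also have "\<dots> \<le> x * x ^ J / (x - 1)" using x1 by (intro divide_right_mono) auto
        also have "x ^ J \<le> N powr (1 - s)"
          using J 3 unfolding x_def dyadic_powr[symmetric] by (intro powr_mono2) auto
        finally have "(\<Sum>j<J + 1. x ^ j) \<le> x * N powr (1 - s) / (x - 1)"
          using x1 by (simp add: divide_right_mono mult_left_mono)
        then have "(\<Sum>j<J + 1. a j) \<le> x * N powr (1 - s) / (x - 1) / N"
          using h N by (smt (verit) divide_right_mono)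
        also have "\<dots> = x / (x - 1) * loss_rate s N"
          using 3 N by (simp add: loss_rate_def powr_diff powr_minus divide_simps)
        finally show ?thesis using 3 by simp
      qed
    qed
    have "(\<Sum>j. ennreal (a j)) = ennreal (\<Sum>j. a j)"
      using a0 sm by (intro suminf_ennreal2) auto
    also have "(\<Sum>j. a j) = (\<Sum>j. a (j + (J + 1))) + (\<Sum>j<J + 1. a j)"
      using sm by (rule suminf_split_initial_segment)
    also have "ennreal \<dots> \<le> ennreal (C * loss_rate s N)"
    proof (rule ennreal_leI)
      have "1 / (1 - y) * N powr - s \<le> 1 / (1 - y) * loss_rate s N"
        using ls y by (intro mult_left_mono) auto
      then show "(\<Sum>j. a (j + (J + 1))) + (\<Sum>j<J + 1. a j) \<le> C * loss_rate s N"
        unfolding C_def ring_distribs using tail head by linarith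
    qed
    finally show ?thesis by (simp add: a_def)
  qed
  ultimately show ?thesis by blast
qed

context doubling_space
begin

text \<open>Dyadic shells: the points with 2^j \<le> \<rho> x y + 1 < 2^(j+1) lie in a ball of at
  most D1 2^((j+1)d) points, which cancels the d in the kernel exponent and leaves the sum of
  \<open>dyadic_sum_le\<close>. At N = 1 the minimum is 1 and this is the plain row sum of the
  kernel.\<close>

lemma kernel_row_sum:
  assumes s: "s > 0"
  shows "\<exists>C>0. \<forall>N\<ge>1. \<forall>x\<in>V.
    (\<integral>\<^sup>+y. ennreal (real (\<rho> x y + 1) powr - (d + s) * min 1 (real (\<rho> x y + 1) / N)) \<partial>count_space V)
      \<le> ennreal (C * loss_rate s N)"
proof -
  obtain C where C: "C > 0" and dy: "\<And>N. N \<ge> 1 \<Longrightarrow>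
      (\<Sum>j. ennreal ((2 ^ j) powr - s * min 1 (2 ^ j / N))) \<le> ennreal (C * loss_rate s N)"
    using dyadic_sum_le[OF s] by blast
  define C' where "C' = D1 * 2 powr (d + 1)"
  have C': "C' > 0" using D1 by (simp add: C'_def)
  have "(\<integral>\<^sup>+y. ennreal (real (\<rho> x y + 1) powr - (d + s) * min 1 (real (\<rho> x y + 1) / N)) \<partial>count_space V)
      \<le> ennreal (C' * C * loss_rate s N)" if N: "N \<ge> 1" and x: "x \<in> V" for N x
  proof -
    \<comment> \<open>Twice the kernel value at the left end of a shell, as min 1 (2 * 2^j / N)
      \<le> 2 min 1 (2^j / N). Below, whole balls carry these values instead of shells, which only
      overcounts.\<close>
    define b where "b j = 2 * ((2 ^ j) powr - (d + s) * min 1 (2 ^ j / N))" for j :: nat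
    have b0: "b j \<ge> 0" for j using N by (simp add: b_def)
    have "(\<integral>\<^sup>+y. ennreal (real (\<rho> x y + 1) powr - (d + s) * min 1 (real (\<rho> x y + 1) / N)) \<partial>count_space V)
      \<le> (\<integral>\<^sup>+y. (\<Sum>j. ennreal (b j) * indicator (bl x (2 ^ (j + 1) - 1)) y) \<partial>count_space V)"
    proof (intro nn_integral_mono)
      fix y assume "y \<in> space (count_space V)"
      then have y: "y \<in> V" by simp
      obtain j where j: "2 ^ j \<le> \<rho> x y + 1" "\<rho> x y + 1 < 2 ^ (j + 1)"
        using ex_power_ivl1[of 2 "\<rho> x y + 1"] by auto
      have j': "(2::real) ^ j \<le> real (\<rho> x y + 1)"
        using j(1) by (metis numeral_power_le_of_nat_cancel_iff)
      have "real (\<rho> x y + 1) < 2 ^ (j + 1)"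
        using j(2) by (metis of_nat_less_numeral_power_cancel_iff)
      then have j'': "real (\<rho> x y + 1) \<le> 2 * 2 ^ j" and yb: "y \<in> bl x (2 ^ (j + 1) - 1)"
        using y by (auto simp: bl_def)
      have "real (\<rho> x y + 1) powr - (d + s) * min 1 (real (\<rho> x y + 1) / N)
          \<le> (2 ^ j) powr - (d + s) * min 1 (2 * 2 ^ j / N)"
        using j' j'' N d s by (intro mult_mono powr_mono2' min.mono divide_right_mono) auto
      also have "\<dots> \<le> (2 ^ j) powr - (d + s) * (2 * min 1 (2 ^ j / N))"
        by (intro mult_left_mono) auto
      finally have "ennreal (real (\<rho> x y + 1) powr - (d + s) * min 1 (real (\<rho> x y + 1) / N))
          \<le> ennreal (b j) * indicator (bl x (2 ^ (j + 1) - 1)) y"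
        using yb by (simp add: b_def ennreal_leI mult.left_commute)
      also have "\<dots> \<le> (\<Sum>j. ennreal (b j) * indicator (bl x (2 ^ (j + 1) - 1)) y)"
      proof -
        define g where "g j = ennreal (b j) * indicator (bl x (2 ^ (j + 1) - 1)) y" for j
        have "sum g {j} \<le> suminf g" by (rule sum_le_suminf) auto
        then have "g j \<le> suminf g" by simp
        then show ?thesis unfolding g_def .
      qed
      finally show "ennreal (real (\<rho> x y + 1) powr - (d + s) * min 1 (real (\<rho> x y + 1) / N))
          \<le> (\<Sum>j. ennreal (b j) * indicator (bl x (2 ^ (j + 1) - 1)) y)" .
    qed
    also have "\<dots> = (\<Sum>j. ennreal (b j) * of_nat (card (bl x (2 ^ (j + 1) - 1))))"
      using finite_bl[OF x] bl_subset
      by (subst nn_integral_suminf) (auto simp: nn_integral_cmult_indicator intro!: suminf_cong)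
    also have "\<dots> \<le> (\<Sum>j. ennreal C' * ennreal ((2 ^ j) powr - s * min 1 (2 ^ j / N)))"
    proof (intro suminf_le)
      fix j :: nat
      have "real (card (bl x (2 ^ (j + 1) - 1))) \<le> D1 * (2 ^ (j + 1)) powr d"
        using growth[OF x, of "2 ^ (j + 1) - 1"] one_le_power[of "2::real" "j + 1"] by simp
      then have "b j * real (card (bl x (2 ^ (j + 1) - 1))) \<le> b j * (D1 * (2 ^ (j + 1)) powr d)"
        using b0 by (intro mult_left_mono) auto
      also have "\<dots> = C' * ((2 ^ j) powr - s * min 1 (2 ^ j / N))"
      proof -
        have "(2 * 2 ^ j :: real) powr d = 2 powr d * (2 ^ j) powr d" by (rule powr_mult)
        moreover have "((2::real) ^ j) powr - (d + s) * (2 ^ j) powr d = (2 ^ j) powr - s"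
          by (simp flip: powr_add)
        moreover have "(2::real) powr (d + 1) = 2 * 2 powr d" by (simp add: powr_add)
        ultimately show ?thesis by (simp add: b_def C'_def mult_ac)
      qed
      finally have "ennreal (b j * real (card (bl x (2 ^ (j + 1) - 1))))
          \<le> ennreal (C' * ((2 ^ j) powr - s * min 1 (2 ^ j / N)))"
        by (rule ennreal_leI)
      then show "ennreal (b j) * of_nat (card (bl x (2 ^ (j + 1) - 1)))
          \<le> ennreal C' * ennreal ((2 ^ j) powr - s * min 1 (2 ^ j / N))"
        using b0 C' N by (simp add: ennreal_mult ennreal_of_nat_eq_real_of_nat)
    qed auto
    also have "\<dots> = ennreal C' * (\<Sum>j. ennreal ((2 ^ j) powr - s * min 1 (2 ^ j / N)))"
      by (rule ennreal_suminf_cmult)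
    also have "\<dots> \<le> ennreal C' * ennreal (C * loss_rate s N)"
      using dy[OF N] by (intro mult_left_mono) auto
    also have "\<dots> = ennreal (C' * C * loss_rate s N)"
      using C C' N by (simp add: ennreal_mult' mult.assoc)
    finally show ?thesis .
  qed
  then show ?thesis using C C' by (intro exI[of _ "C' * C"]) auto
qed

section \<open>Cutoff functions at scale N\<close>

definition cutoff :: "real \<Rightarrow> 'a \<Rightarrow> 'a \<Rightarrow> real" where
  "cutoff N m x = max 0 (min 1 (2 - real (\<rho> m x) / N))"

text \<open>\<open>\<rho> x y + 1\<close> in place of the sharper \<open>\<rho> x y\<close> gives
  exactly the truncation factor of the kernel in \<open>kernel_row_sum\<close>.\<close>

lemma cutoff_lipschitz:
  assumes "m \<in> V" "x \<in> V" "y \<in> V" "N > 0"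
  shows "\<bar>cutoff N m y - cutoff N m x\<bar> \<le> min 1 (real (\<rho> x y + 1) / N)"
proof -
  have "real (\<rho> m x) \<le> real (\<rho> m y) + real (\<rho> x y)" "real (\<rho> m y) \<le> real (\<rho> m x) + real (\<rho> x y)"
    using dist_triangle[of m x y] dist_triangle[of m y x] dist_sym[of x y] assms by linarith+
  then have "real (\<rho> m x) / N \<le> (real (\<rho> m y) + real (\<rho> x y)) / N"
    "real (\<rho> m y) / N \<le> (real (\<rho> m x) + real (\<rho> x y)) / N"
    using assms by (intro divide_right_mono; simp)+
  moreover have "real (\<rho> x y) / N \<le> real (\<rho> x y + 1) / N" using assms by (simp add: divide_right_mono)
  ultimately show ?thesis unfolding cutoff_def add_divide_distrib by linarith
qed

lemma cutoff_bounds: "0 \<le> cutoff N m x" "cutoff N m x \<le> 1"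
  by (auto simp: cutoff_def)

lemma cutoff_eq_1: "N > 0 \<Longrightarrow> x \<in> bl m N \<Longrightarrow> cutoff N m x = 1"
  by (simp add: cutoff_def bl_def field_simps min_def max_def)

lemma cutoff_eq_0: "N > 0 \<Longrightarrow> x \<in> V \<Longrightarrow> x \<notin> bl m (2 * N) \<Longrightarrow> cutoff N m x = 0"
  by (simp add: cutoff_def bl_def field_simps min_def max_def)

subsection \<open>Local stability estimate\<close>

text \<open>The key estimate.  On \<open>bl m (4 * N)\<close> the function \<open>f\<close> below dominates the commutator
  of \<open>A\<close> with the cutoff; off that ball only pairs at distance at least
  \<open>N\<close> contribute, where \<open>min 1 _ = 1\<close> and the truncated kernel still dominates \<open>A\<close>.\<close>
lemma stability_inequality:
  assumes p: "1 \<le> p" and q: "1 \<le> q" and N: "N \<ge> 1"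
    and A: "\<And>x y. x \<in> V \<Longrightarrow> y \<in> V \<Longrightarrow> norm (A x y) \<le> k (\<rho> x y)"
    and k: "\<And>n. k n \<ge> 0"
    and row1: "\<And>x. x \<in> V \<Longrightarrow> (\<integral>\<^sup>+y. ennreal (k (\<rho> x y)) \<partial>count_space V) < \<infinity>"
    and row: "\<And>x. x \<in> V \<Longrightarrow>
      (\<integral>\<^sup>+y. ennreal (k (\<rho> x y) * min 1 (real (\<rho> x y + 1) / N)) \<partial>count_space V) \<le> ennreal \<kappa>"
    and \<kappa>: "\<kappa> > 0"
    and stable: "lp_stable V p A Ap" and Ap: "Ap > 0"
    and c: "lp_norm V q c \<le> ennreal X" "X \<ge> 0"
    and Ac: "lp_norm V q (mat_apply V A c) \<le> ennreal Y" "Y \<ge> 0"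
  shows "lp_norm V q c \<le> ennreal (D0 ^ 4 *
    (48 * (D1 * (4 * N + 1) powr d) powr \<bar>recip p - recip q\<bar> / Ap) * (4 * Y + 48 * \<kappa> * X))"
proof -
  define M where "M = D1 * (4 * N + 1) powr d"
  have M: "M \<ge> 1"
    unfolding M_def using D1 N d mult_mono[of 1 D1 1 "(4 * N + 1) powr d"] by (simp add: ge_one_powr_ge_zero)
  define G where "G x y = k (\<rho> x y) * min 1 (real (\<rho> x y + 1) / N)" for x y
  have G0: "G x y \<ge> 0" for x y using k N by (simp add: G_def)
  have Gk: "G x y \<le> k (\<rho> x y)" for x y
    unfolding G_def by (rule mult_left_le[OF _ k]) simp
  have Gsym: "G x y = G y x" if "x \<in> V" "y \<in> V" for x y using dist_sym that by (simp add: G_def)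
  have Grow: "(\<integral>\<^sup>+y. ennreal (G x y) \<partial>count_space V) \<le> ennreal \<kappa>" if "x \<in> V" for x
    using row[OF that] by (simp add: G_def)
  have cX: "norm (c x) \<le> X" if "x \<in> V" for x using norm_le_lp_norm[OF q c that] .
  have k_bounded: "(\<integral>\<^sup>+y. ennreal (k (\<rho> x y) * norm (h y)) \<partial>count_space V) < \<infinity>"
    if x: "x \<in> V" and h: "\<And>y. y \<in> V \<Longrightarrow> norm (h y) \<le> X" for x and h :: "'a \<Rightarrow> complex"
  proof -
    have "(\<integral>\<^sup>+y. ennreal (k (\<rho> x y) * norm (h y)) \<partial>count_space V)
        \<le> (\<integral>\<^sup>+y. ennreal (k (\<rho> x y)) * ennreal X \<partial>count_space V)"
      using h k c(2) by (intro nn_integral_mono) (auto simp flip: ennreal_mult intro!: ennreal_leI mult_left_mono)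
    also have "\<dots> = (\<integral>\<^sup>+y. ennreal (k (\<rho> x y)) \<partial>count_space V) * ennreal X"
      by (simp add: nn_integral_multc)
    also have "\<dots> < \<infinity>" using row1[OF x] by (simp add: ennreal_mult_less_top)
    finally show ?thesis .
  qed
  \<comment> \<open>Real-valued form of the operator with kernel \<open>G\<close> acting on absolute
    values. \<open>enn2real\<close> would return 0 on an infinite integral; the bound norm (h y)
    \<le> X excludes this.\<close>
  define T where "T h x = enn2real (\<integral>\<^sup>+y. ennreal (G x y * norm (h y)) \<partial>count_space V)"
    for h :: "'a \<Rightarrow> complex" and x
  have T0: "T h x \<ge> 0" for h x by (simp add: T_def)
  have T: "(\<integral>\<^sup>+y. ennreal (G x y * norm (h y)) \<partial>count_space V) = ennreal (T h x)"
    if x: "x \<in> V" and h: "\<And>y. y \<in> V \<Longrightarrow> norm (h y) \<le> X" for x h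
  proof -
    have "(\<integral>\<^sup>+y. ennreal (G x y * norm (h y)) \<partial>count_space V)
       \<le> (\<integral>\<^sup>+y. ennreal (k (\<rho> x y) * norm (h y)) \<partial>count_space V)"
      using Gk by (intro nn_integral_mono ennreal_leI mult_right_mono) auto
    also have "\<dots> < \<infinity>" by (rule k_bounded[OF x h])
    finally show ?thesis by (simp add: T_def)
  qed
  have Tc: "(\<integral>\<^sup>+y. ennreal (G x y * norm (c y)) \<partial>count_space V) = ennreal (T c x)" if "x \<in> V" for x
    by (rule T[OF that cX])
  have T_schur: "lp_norm V s (\<lambda>x. complex_of_real (T h x)) \<le> ennreal (2 * \<kappa> * H)"
    if "1 \<le> s" "lp_norm V s h \<le> ennreal H" "H \<ge> 0" "\<And>y. y \<in> V \<Longrightarrow> norm (h y) \<le> X" for s h H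
    using that(1) G0 Gsym Grow \<kappa> that(2,3)
    by (rule lp_norm_schur) (use T that(4) T0 in auto)
  \<comment> \<open>On the ball, |A c| and T c together bound A (\<psi> c), T c being the share of
    the commutator. The term \<open>\<kappa> * norm (c x)\<close> is there to make
    \<open>norm (f x) / \<kappa>\<close> a bound for |\<psi> c|.\<close>
  define f where "f x = complex_of_real (norm (mat_apply V A c x) + T c x + \<kappa> * norm (c x))" for x
  have norm_f: "norm (f x) = norm (mat_apply V A c x) + T c x + \<kappa> * norm (c x)" for x
    unfolding f_def norm_of_real using T0[of c x] \<kappa> by simp
  \<comment> \<open>48 = 4 * 4 * 3: two triangle inequalities, and 2\<kappa> + \<kappa>.\<close>
  have fN: "lp_norm V q f \<le> ennreal (4 * Y + 48 * \<kappa> * X)"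
  proof -
    have 1: "lp_norm V q (\<lambda>x. complex_of_real (T c x)) \<le> ennreal (2 * \<kappa> * X)"
      using T_schur[OF q c cX] .
    have 2: "lp_norm V q (\<lambda>x. complex_of_real (\<kappa> * norm (c x))) \<le> ennreal (\<kappa> * X)"
      using \<kappa> by (intro lp_norm_scale[OF q c]) (auto simp: norm_mult)
    have 3: "lp_norm V q (\<lambda>x. complex_of_real (T c x + \<kappa> * norm (c x))) \<le> ennreal (4 * (2 * \<kappa> * X + \<kappa> * X))"
      using \<kappa> c(2) by (intro lp_norm_add_le[OF q 1 _ 2]) (auto simp: norm_mult intro: order_trans[OF norm_triangle_ineq])
    have "lp_norm V q f \<le> ennreal (4 * (Y + 4 * (2 * \<kappa> * X + \<kappa> * X)))"
    proof (rule lp_norm_add_le[OF q Ac 3])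
      fix x
      have "norm (complex_of_real (T c x + \<kappa> * norm (c x))) = T c x + \<kappa> * norm (c x)"
        unfolding norm_of_real using T0[of c x] \<kappa> by simp
      then show "norm (f x) \<le> norm (mat_apply V A c x) + norm (complex_of_real (T c x + \<kappa> * norm (c x)))"
        by (simp only: norm_f)
    qed (use \<kappa> c(2) in simp)
    also have "4 * (Y + 4 * (2 * \<kappa> * X + \<kappa> * X)) = 4 * Y + 48 * \<kappa> * X" by simp
    finally show ?thesis .
  qed
  have local_bound: "lp_norm V q (\<lambda>x. if x \<in> bl m N then c x else 0)
      \<le> ennreal (48 * M powr \<bar>recip p - recip q\<bar> / Ap * F)"
    if m: "m \<in> V" and F: "F \<ge> 0" and fF: "lp_norm V q (\<lambda>x. if x \<in> bl m (4 * N) then f x else 0) \<le> ennreal F"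
    for m F
  proof -
    define \<psi> where "\<psi> = cutoff N m"
    have \<psi>: "0 \<le> \<psi> x" "\<psi> x \<le> 1" for x using cutoff_bounds by (auto simp: \<psi>_def)
    have \<psi>0: "\<psi> x = 0" if "x \<in> V" "x \<notin> bl m (2 * N)" for x
      using cutoff_eq_0[of N x m] that N by (simp add: \<psi>_def)
    define \<phi> where "\<phi> x = complex_of_real (\<psi> x) * c x" for x
    have norm_\<phi>: "norm (\<phi> x) = \<psi> x * norm (c x)" for x using \<psi> by (simp add: \<phi>_def norm_mult)
    have \<phi>c: "norm (\<phi> x) \<le> norm (c x)" for x
      unfolding norm_\<phi> using \<psi> by (simp add: mult_left_le_one_le)
    have \<phi>X: "norm (\<phi> x) \<le> X" if "x \<in> V" for x using \<phi>c[of x] cX[OF that] by simp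
    have T\<phi>_eq: "(\<integral>\<^sup>+y. ennreal (G x y * norm (\<phi> y)) \<partial>count_space V) = ennreal (T \<phi> x)"
      if "x \<in> V" for x
      by (rule T[OF that \<phi>X])
    \<comment> \<open>At least one of the two exponents vanishes. \<open>e1\<close> is paid for
      passing from q to p on \<open>f4\<close>, \<open>e2\<close> for returning from p to q on
      \<open>\<phi>\<close>, so the total price is M^|1/p - 1/q|.\<close>
    define e1 e2 where "e1 = max 0 (recip p - recip q)" and "e2 = max 0 (recip q - recip p)"
    define f4 where "f4 x = (if x \<in> bl m (4 * N) then f x else 0)" for x
    have card4: "real (card (bl m (4 * N))) \<le> M"
      using growth[OF m, of "4 * N"] N by (simp add: M_def)
    have bl24: "bl m (2 * N) \<subseteq> bl m (4 * N)" using N by (auto simp: bl_def)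
    define F1 where "F1 = 2 * M powr e1 * F"
    have F1: "F1 \<ge> 0" using F by (simp add: F1_def)
    have f4: "lp_norm V p f4 \<le> ennreal F1"
      unfolding F1_def e1_def using fF F M
      by (intro lp_norm_change_exponent[OF p q _ _ finite_bl[OF m] bl_subset card4]) (auto simp: f4_def[abs_def])
    have \<phi>f4: "norm (\<phi> x) \<le> 1 / \<kappa> * norm (f4 x)" if x: "x \<in> V" for x
    proof (cases "x \<in> bl m (4 * N)")
      case True
      have "\<kappa> * norm (\<phi> x) \<le> \<kappa> * norm (c x)" using \<phi>c \<kappa> by (intro mult_left_mono) auto
      also have "\<dots> \<le> norm (f4 x)" using True T0[of c x] by (simp add: f4_def norm_f)
      finally show ?thesis using \<kappa> by (simp add: field_simps)
    next
      case False
      then have "\<psi> x = 0" using \<psi>0[OF x] bl24 by auto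
      then show ?thesis using \<kappa> by (simp add: norm_\<phi>)
    qed
    \<comment> \<open>Used twice: it puts \<open>\<phi>\<close> into \<open>lp_space V p\<close>,
      where stability applies, and it feeds Schur's test below, where 1/\<kappa> cancels the row
      sum.\<close>
    have \<phi>p: "lp_norm V p \<phi> \<le> ennreal (1 / \<kappa> * F1)"
      using \<kappa> \<phi>f4 by (intro lp_norm_scale[OF p f4 F1]) auto
    have "lp_norm V p (\<lambda>x. complex_of_real (T \<phi> x)) \<le> ennreal (2 * \<kappa> * (1 / \<kappa> * F1))"
      using F1 \<kappa> by (intro T_schur[OF p \<phi>p _ \<phi>X]) auto
    then have T\<phi>: "lp_norm V p (\<lambda>x. complex_of_real (T \<phi> x)) \<le> ennreal (2 * F1)"
      using \<kappa> by simp
    have pointwise: "norm (mat_apply V A \<phi> x) \<le> norm (f4 x) + norm (complex_of_real (T \<phi> x))"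
      if x: "x \<in> V" for x
    proof (cases "x \<in> bl m (4 * N)")
      case True
      define g where "g y = A x y * complex_of_real (\<psi> y - \<psi> x) * c y" for y
      have int: "(\<integral>\<^sup>+y. ennreal (norm (A x y * c y)) \<partial>count_space V) < \<infinity>"
      proof -
        have "(\<integral>\<^sup>+y. ennreal (norm (A x y * c y)) \<partial>count_space V)
            \<le> (\<integral>\<^sup>+y. ennreal (k (\<rho> x y) * norm (c y)) \<partial>count_space V)"
          using A x by (intro nn_integral_mono) (auto simp: norm_mult intro!: ennreal_leI mult_right_mono)
        also have "\<dots> < \<infinity>" using k_bounded[OF x cX] .
        finally show ?thesis .
      qed
      have gG: "norm (g y) \<le> G x y * norm (c y)" if y: "y \<in> V" for y
      proof -
        have "norm (g y) = norm (A x y) * \<bar>\<psi> y - \<psi> x\<bar> * norm (c y)"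
          unfolding g_def norm_mult norm_of_real ..
        also have "\<dots> \<le> k (\<rho> x y) * min 1 (real (\<rho> x y + 1) / N) * norm (c y)"
          using A[OF x y] k cutoff_lipschitz[OF m x y, of N] N
          by (intro mult_right_mono mult_mono) (auto simp: \<psi>_def)
        finally show ?thesis by (simp add: G_def)
      qed
      have g_int: "(\<integral>\<^sup>+y. ennreal (norm (g y)) \<partial>count_space V) \<le> ennreal (T c x)"
        unfolding Tc[OF x, symmetric] using gG by (intro nn_integral_mono ennreal_leI) auto
      then have g_fin: "(\<integral>\<^sup>+y. ennreal (norm (g y)) \<partial>count_space V) < \<infinity>"
        by (rule order_le_less_trans) simp
      \<comment> \<open>\<open>infsum g V\<close> is the commutator applied to c; both series
        converge absolutely, so the sum may be split.\<close>
      have "mat_apply V A \<phi> x = (\<Sum>\<^sub>\<infinity>y\<in>V. complex_of_real (\<psi> x) * (A x y * c y) + g y)"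
        unfolding mat_apply_def by (intro infsum_cong) (simp add: \<phi>_def g_def algebra_simps)
      also have "\<dots> = complex_of_real (\<psi> x) * mat_apply V A c x + infsum g V"
        unfolding mat_apply_def
        using infsum_norm_le_nn_integral(1)[OF int] infsum_norm_le_nn_integral(1)[OF g_fin]
        by (subst infsum_add) (auto intro: summable_on_cmult_right simp: infsum_cmult_right)
      finally have "norm (mat_apply V A \<phi> x) \<le> \<psi> x * norm (mat_apply V A c x) + norm (infsum g V)"
        using norm_triangle_ineq[of "complex_of_real (\<psi> x) * mat_apply V A c x" "infsum g V"] \<psi>[of x]
        by (simp add: norm_mult)
      also have "\<psi> x * norm (mat_apply V A c x) \<le> norm (mat_apply V A c x)"
        using \<psi>[of x] by (simp add: mult_left_le_one_le)
      also have "norm (infsum g V) \<le> T c x"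
      proof -
        have "ennreal (norm (infsum g V)) \<le> ennreal (T c x)"
          using infsum_norm_le_nn_integral(2)[OF g_fin] g_int by (rule order_trans)
        then show ?thesis using T0 by (simp add: ennreal_le_iff)
      qed
      finally have "norm (mat_apply V A \<phi> x) \<le> norm (f x)"
        using norm_f[of x] mult_nonneg_nonneg[OF less_imp_le[OF \<kappa>] norm_ge_zero[of "c x"]] by linarith
      then show ?thesis using True T0[of \<phi> x] by (simp add: f4_def)
    next
      case False
      have hG: "norm (A x y * \<phi> y) \<le> G x y * norm (\<phi> y)" if y: "y \<in> V" for y
      proof (cases "y \<in> bl m (2 * N)")
        case True
        have "real (\<rho> m y) \<le> 2 * N" "real (\<rho> m x) > 4 * N" using True False x by (auto simp: bl_def)
        moreover have "real (\<rho> m x) \<le> real (\<rho> m y) + real (\<rho> x y)"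
          using dist_triangle[OF m y x] dist_sym[OF x y] by linarith
        ultimately have "min 1 (real (\<rho> x y + 1) / N) = 1" using N by (simp add: field_simps)
        then have "norm (A x y) \<le> G x y" using A[OF x y] by (simp add: G_def)
        then show ?thesis by (simp add: norm_mult mult_right_mono)
      next
        case False
        then show ?thesis using \<psi>0[OF y] by (simp add: \<phi>_def)
      qed
      have h_int: "(\<integral>\<^sup>+y. ennreal (norm (A x y * \<phi> y)) \<partial>count_space V) \<le> ennreal (T \<phi> x)"
        unfolding T\<phi>_eq[OF x, symmetric] using hG by (intro nn_integral_mono ennreal_leI) auto
      then have h_fin: "(\<integral>\<^sup>+y. ennreal (norm (A x y * \<phi> y)) \<partial>count_space V) < \<infinity>"
        by (rule order_le_less_trans) simp
      have "ennreal (norm (mat_apply V A \<phi> x)) \<le> ennreal (T \<phi> x)"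
        unfolding mat_apply_def using infsum_norm_le_nn_integral(2)[OF h_fin] h_int by (rule order_trans)
      then have "norm (mat_apply V A \<phi> x) \<le> T \<phi> x" using T0 by (simp add: ennreal_le_iff)
      then show ?thesis using False T0[of \<phi> x] by (simp add: f4_def)
    qed
    have "lp_norm V p (mat_apply V A \<phi>) \<le> ennreal (4 * (F1 + 2 * F1))"
      using F1 by (intro lp_norm_add_le[OF p f4 F1 T\<phi> _ pointwise]) auto
    moreover have "\<phi> \<in> lp_space V p"
      using \<phi>p by (auto simp: lp_space_def intro: order_le_less_trans)
    ultimately have *: "ennreal Ap * lp_norm V p \<phi> \<le> ennreal (12 * F1)"
      using stable by (auto simp: lp_stable_def intro: order_trans)
    have \<phi>p': "lp_norm V p \<phi> \<le> ennreal (12 * F1 / Ap)"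
    proof -
      obtain t where t: "lp_norm V p \<phi> = ennreal t" "t \<ge> 0"
        using \<phi>p by (cases "lp_norm V p \<phi>" rule: ennreal_cases) (auto simp: top_unique)
      have "ennreal (Ap * t) \<le> ennreal (12 * F1)" using * t Ap by (simp add: ennreal_mult)
      then have "Ap * t \<le> 12 * F1" using F1 by (simp add: ennreal_le_iff)
      then show ?thesis using t Ap by (simp add: field_simps ennreal_leI)
    qed
    \<comment> \<open>\<open>\<psi>\<close> is 1 on \<open>bl m N\<close>. The factor 48 collects 12
      = 4 (1 + 2) from the triangle inequality and a 2 from each of the two changes of
      exponent.\<close>
    have "lp_norm V q (\<lambda>x. if x \<in> bl m N then c x else 0) \<le> lp_norm V q \<phi>"
      using q N cutoff_eq_1[of N _ m] by (intro lp_norm_mono) (auto simp: norm_\<phi> \<psi>_def intro!: mult_nonneg_nonneg cutoff_bounds)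
    also have "\<dots> \<le> ennreal (2 * M powr e2 * (12 * F1 / Ap))"
      unfolding e2_def using F1 Ap M \<psi>0 bl24
      by (intro lp_norm_change_exponent[OF q p \<phi>p' _ finite_bl[OF m] bl_subset card4]) (auto simp: \<phi>_def)
    also have "2 * M powr e2 * (12 * F1 / Ap) = 48 * (M powr e1 * M powr e2) / Ap * F"
      by (simp add: F1_def)
    also have "M powr e1 * M powr e2 = M powr \<bar>recip p - recip q\<bar>"
      by (auto simp: e1_def e2_def max_def abs_if simp flip: powr_add)
    finally show ?thesis .
  qed
  have "lp_norm V q c \<le> ennreal (D0 ^ 4 * (48 * M powr \<bar>recip p - recip q\<bar> / Ap) * (4 * Y + 48 * \<kappa> * X))"
    by (rule lp_norm_local_to_global[OF q _ _ fN _ local_bound]) (use N Ap \<kappa> c(2) Ac(2) in auto)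
  then show ?thesis by (simp only: M_def)
qed

end

subsection \<open>Choice of the scale and one step between exponents\<close>

text \<open>Unifies the two cases of the theorem, \<open>s = 1\<close> being \<alpha> = 1 +
  d/r'.\<close>

definition log_factor :: "real \<Rightarrow> real \<Rightarrow> real" where
  "log_factor s t = (if s = 1 then ln (1 + t) else 1)"

lemma log_factor_pos: "t > 0 \<Longrightarrow> log_factor s t > 0"
  by (simp add: log_factor_def)

lemma log_factor_mono: "0 < t \<Longrightarrow> t \<le> u \<Longrightarrow> log_factor s t \<le> log_factor s u"
  by (simp add: log_factor_def)

lemma log_factor_le: "t > 0 \<Longrightarrow> log_factor s t \<le> 1 + t"
  using ln_add_one_self_le_self[of t] by (simp add: log_factor_def)

text \<open>N is defined by N^\<gamma> = E' t L with L = \<open>log_factor s t\<close>. Without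
  logarithm E' \<ge> E makes the loss small enough. For s = 1 the loss carries ln N, which is at
  most a multiple of L, uniformly for \<gamma> \<ge> \<gamma>0 and t \<ge> t0; but the multiple
  grows with ln E', so that E' has to satisfy the implicit condition
  \<open>a + b * ln E' \<le> E'\<close>.\<close>

lemma choose_scale:
  fixes E \<gamma>0 t0 :: real
  assumes E: "E > 0" and \<gamma>0: "\<gamma>0 > 0" and t0: "t0 > 0"
  shows "\<exists>E'\<ge>1. \<forall>\<gamma> t. \<gamma>0 \<le> \<gamma> \<longrightarrow> t0 \<le> t \<longrightarrow>
    (\<exists>N\<ge>1. E * t * (N powr - \<gamma> * (if s = 1 then 1 + ln N else 1)) \<le> 1
      \<and> N powr \<gamma> = E' * (t * log_factor s t))"
proof -
  define L0 where "L0 = ln (1 + t0)"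
  have L0: "L0 > 0" using t0 by (simp add: L0_def)
  define a where "a = E * (1 / L0 + 2 / \<gamma>0)"
  define b where "b = E * (1 / (\<gamma>0 * L0))"
  have a: "a \<ge> 0" and b: "b \<ge> 0" using E L0 \<gamma>0 by (auto simp: a_def b_def)
  \<comment> \<open>\<open>a + 2 * b + 1\<close> serves the implicit condition, solved by E' = m^2
    because ln E' \<le> 2 m; \<open>E\<close> serves the case without logarithm; the last two terms
    give \<open>Z \<ge> 1\<close>, one for each case of \<open>log_factor\<close>.\<close>
  define m where "m = a + 2 * b + 1 + E + 1 / t0 + 1 / (t0 * L0)"
  have m1: "m \<ge> 1" "m \<ge> a + 2 * b + 1" "m \<ge> E" "m \<ge> 1 / t0" "m \<ge> 1 / (t0 * L0)"
    using a b E t0 L0 by (auto simp: m_def)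
  define E' where "E' = m ^ 2"
  have mE: "m \<le> E'" using m1(1) mult_left_mono[of 1 m m] by (simp add: E'_def power2_eq_square)
  then have E'1: "E' \<ge> 1" using m1 by simp
  have "ln E' \<le> 2 * m"
    using ln_le_minus_one[of m] m1(1) by (simp add: E'_def ln_realpow)
  then have "a + b * ln E' \<le> a + b * (2 * m)" using b by (intro add_left_mono mult_left_mono) auto
  also have "\<dots> \<le> a * m + 2 * b * m + m"
    using m1(1) mult_left_mono[OF m1(1) a] by simp
  also have "\<dots> = m * (a + 2 * b + 1)" by (simp add: algebra_simps)
  also have "\<dots> \<le> E'" unfolding E'_def power2_eq_square using m1 by (intro mult_left_mono) auto
  finally have key: "a + b * ln E' \<le> E'" .
  have "\<exists>N\<ge>1. E * t * (N powr - \<gamma> * (if s = 1 then 1 + ln N else 1)) \<le> 1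
      \<and> N powr \<gamma> = E' * (t * log_factor s t)" if \<gamma>: "\<gamma>0 \<le> \<gamma>" and t: "t0 \<le> t" for \<gamma> t
  proof -
    define Z where "Z = E' * (t * log_factor s t)"
    define N where "N = Z powr (1 / \<gamma>)"
    have \<gamma>': "\<gamma> > 0" and t': "t > 0" using \<gamma> \<gamma>0 t t0 by auto
    have Z1: "Z \<ge> 1"
    proof -
      have "1 \<le> E' * (t0 * log_factor s t0)"
      proof -
        have "1 / (t0 * log_factor s t0) \<le> m" using m1(4,5) by (simp add: log_factor_def L0_def)
        with mE have "1 / (t0 * log_factor s t0) \<le> E'" by linarith
        then show ?thesis using t0 log_factor_pos[OF t0, of s] by (simp add: divide_le_eq)
      qed
      also have "\<dots> \<le> Z"
        unfolding Z_def using t t0 E'1 log_factor_pos[of t0 s]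
        by (intro mult_left_mono mult_mono log_factor_mono) auto
      finally show ?thesis .
    qed
    have N1: "N \<ge> 1" using Z1 \<gamma>' by (simp add: N_def ge_one_powr_ge_zero)
    have NZ: "N powr \<gamma> = Z" using Z1 \<gamma>' by (simp add: N_def powr_powr)
    have lnN: "ln N = ln Z / \<gamma>" using Z1 by (simp add: N_def)
    have "E * t * (if s = 1 then 1 + ln N else 1) \<le> Z"
    proof (cases "s = 1")
      case False
      then show ?thesis using m1(3) mE t' by (simp add: Z_def log_factor_def mult_right_mono)
    next
      case True
      define L where "L = ln (1 + t)"
      have L: "L \<ge> L0" unfolding L_def L0_def using t t0 by simp
      with L0 have L': "L > 0" by simp
      have "ln Z = ln E' + ln t + ln L"
        using True E'1 t' L' by (simp add: Z_def log_factor_def L_def[symmetric] ln_mult)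
      also have "ln t \<le> L" unfolding L_def using t' by simp
      also have "ln L \<le> L" using L' by (rule ln_bound)
      finally have lnZ: "ln Z \<le> ln E' + 2 * L" by simp
      have "1 + ln N \<le> 1 + (ln E' + 2 * L) / \<gamma>0"
      proof -
        have "ln Z / \<gamma> \<le> ln Z / \<gamma>0" using Z1 \<gamma> \<gamma>0 by (intro divide_left_mono) auto
        also have "\<dots> \<le> (ln E' + 2 * L) / \<gamma>0" using lnZ \<gamma>0 by (intro divide_right_mono) auto
        finally show ?thesis by (simp add: lnN)
      qed
      also have "\<dots> \<le> L / L0 + (ln E' * (L / L0) + 2 * L) / \<gamma>0"
      proof -
        have 1: "1 \<le> L / L0" using L L0 by simp
        then have "ln E' * 1 \<le> ln E' * (L / L0)" using E'1 by (intro mult_left_mono) auto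
        with 1 show ?thesis using \<gamma>0 by (intro add_mono divide_right_mono) auto
      qed
      finally have "E * (1 + ln N) \<le> E * (L / L0 + (ln E' * (L / L0) + 2 * L) / \<gamma>0)"
        using E by (intro mult_left_mono) auto
      also have "\<dots> = (a + b * ln E') * L"
        using L0 \<gamma>0 by (simp add: a_def b_def field_simps)
      also have "\<dots> \<le> E' * L" using key L' by (intro mult_right_mono) auto
      finally have "t * (E * (1 + ln N)) \<le> t * (E' * L)" using t' by (intro mult_left_mono) auto
      then show ?thesis using True by (simp add: Z_def log_factor_def L_def mult_ac)
    qed
    then have "E * t * (N powr - \<gamma> * (if s = 1 then 1 + ln N else 1)) \<le> 1"
      using NZ Z1 by (simp add: powr_minus divide_simps mult_ac)
    with N1 NZ show ?thesis unfolding Z_def by blast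
  qed
  with E'1 show ?thesis by blast
qed

text \<open>If u \<le> C (1 + t)^(2M), then ln (1 + u) \<le> ln (2 C) + 2 M ln (1 + t), and t \<ge>
  t0 absorbs the constant. This keeps iterated logarithms from arising.\<close>

lemma log_factor_powr_bound:
  fixes t0 :: real
  assumes t0: "t0 > 0" and C: "C \<ge> 1" and M: "M \<ge> 1"
  shows "\<exists>B\<ge>1. \<forall>t u e. t0 \<le> t \<longrightarrow> 0 < u \<longrightarrow> 1 \<le> e \<longrightarrow> e \<le> M \<longrightarrow>
    u \<le> C * t powr e * log_factor s t powr (e - 1) \<longrightarrow> log_factor s u \<le> B * log_factor s t"
proof -
  define L0 where "L0 = ln (1 + t0)"
  have L0: "L0 > 0" using t0 by (simp add: L0_def)
  define B where "B = ln (2 * C) / L0 + 2 * M"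
  have B: "B \<ge> 1" using M C L0 by (simp add: B_def add_nonneg_nonneg)
      (smt (verit) divide_nonneg_pos ln_ge_zero)
  have "log_factor s u \<le> B * log_factor s t"
    if t: "t0 \<le> t" and u: "0 < u" and e: "1 \<le> e" "e \<le> M"
      and ut: "u \<le> C * t powr e * log_factor s t powr (e - 1)" for t u e
  proof (cases "s = 1")
    case True
    have t': "t > 0" using t t0 by simp
    have "u \<le> C * (1 + t) powr M * (1 + t) powr M"
    proof -
      have "t powr e \<le> (1 + t) powr e" using t' e by (intro powr_mono2) auto
      also have "\<dots> \<le> (1 + t) powr M" using t' e by (intro powr_mono) auto
      finally have 1: "t powr e \<le> (1 + t) powr M" .
      have "log_factor s t powr (e - 1) \<le> (1 + t) powr (e - 1)"
        using t' e log_factor_le log_factor_pos by (intro powr_mono2) (auto intro: less_imp_le)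
      also have "\<dots> \<le> (1 + t) powr M" using t' e by (intro powr_mono) auto
      finally have 2: "log_factor s t powr (e - 1) \<le> (1 + t) powr M" .
      have "C * t powr e * log_factor s t powr (e - 1) \<le> C * (1 + t) powr M * (1 + t) powr M"
        using 1 2 C by (intro mult_mono) auto
      with ut show ?thesis by simp
    qed
    also have "\<dots> = C * (1 + t) powr (2 * M)" by (simp flip: powr_add)
    finally have "1 + u \<le> 1 + C * (1 + t) powr (2 * M)" by simp
    also have "\<dots> \<le> 2 * C * (1 + t) powr (2 * M)"
      using C t' M ge_one_powr_ge_zero[of "1 + t" "2 * M"] mult_mono[of 1 C 1 "(1 + t) powr (2 * M)"] by simp
    finally have "ln (1 + u) \<le> ln (2 * C * (1 + t) powr (2 * M))"
      using u by (subst ln_le_cancel_iff) auto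
    also have "\<dots> = ln (2 * C) + 2 * M * ln (1 + t)"
      using C t' by (simp add: ln_mult)
    also have "ln (2 * C) \<le> ln (2 * C) / L0 * ln (1 + t)"
    proof -
      have "L0 \<le> ln (1 + t)" unfolding L0_def using t t0 by simp
      then have "ln (2 * C) * 1 \<le> ln (2 * C) * (ln (1 + t) / L0)"
        using C L0 by (intro mult_left_mono) auto
      then show ?thesis by simp
    qed
    finally show ?thesis using True by (simp add: log_factor_def B_def algebra_simps)
  next
    case False
    then show ?thesis using B by (simp add: log_factor_def)
  qed
  with B show ?thesis by blast
qed

text \<open>Why the logarithm has exponent e - 1: one more step yields (e - 1)(1 + \<theta>) +
  \<theta> = e (1 + \<theta>) - 1, so the shape is preserved with e (1 + \<theta>) in place of e.
  The bounds \<open>M\<close> and \<open>\<theta>m\<close> make the new constant independent of e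
  and \<theta>.\<close>

lemma iterate_ratio_bound:
  fixes t0 :: real
  assumes t0: "t0 > 0" and C: "C \<ge> 1" and C1: "C1 \<ge> 1" and M: "M \<ge> 1" and \<theta>m: "\<theta>m \<ge> 0"
  shows "\<exists>C'\<ge>1. \<forall>t u e \<theta>. t0 \<le> t \<longrightarrow> 0 < u \<longrightarrow> 1 \<le> e \<longrightarrow> e \<le> M \<longrightarrow> 0 \<le> \<theta> \<longrightarrow> \<theta> \<le> \<theta>m \<longrightarrow>
    u \<le> C * t powr e * log_factor s t powr (e - 1) \<longrightarrow>
    C1 * u * (u * log_factor s u) powr \<theta>
      \<le> C' * t powr (e * (1 + \<theta>)) * log_factor s t powr (e * (1 + \<theta>) - 1)"
proof -
  obtain B where B: "B \<ge> 1" and Bl: "\<And>t u e. t0 \<le> t \<Longrightarrow> 0 < u \<Longrightarrow> 1 \<le> e \<Longrightarrow> e \<le> M \<Longrightarrow>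
    u \<le> C * t powr e * log_factor s t powr (e - 1) \<Longrightarrow> log_factor s u \<le> B * log_factor s t"
    using log_factor_powr_bound[OF t0 C M] by blast
  define C' where "C' = C1 * C powr (1 + \<theta>m) * B powr \<theta>m"
  have "1 * 1 * 1 \<le> C'"
    unfolding C'_def using C C1 B \<theta>m by (intro mult_mono ge_one_powr_ge_zero) auto
  moreover have "C1 * u * (u * log_factor s u) powr \<theta>
      \<le> C' * t powr (e * (1 + \<theta>)) * log_factor s t powr (e * (1 + \<theta>) - 1)"
    if t: "t0 \<le> t" and u: "0 < u" and e: "1 \<le> e" "e \<le> M" and \<theta>: "0 \<le> \<theta>" "\<theta> \<le> \<theta>m"
      and ut: "u \<le> C * t powr e * log_factor s t powr (e - 1)" for t u e \<theta>
  proof -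
    have t': "t > 0" using t t0 by simp
    define L where "L = log_factor s t"
    have L: "L > 0" using t' by (simp add: L_def log_factor_pos)
    have lu: "log_factor s u > 0" using u by (rule log_factor_pos)
    have "C1 * u * (u * log_factor s u) powr \<theta> = C1 * u powr (1 + \<theta>) * log_factor s u powr \<theta>"
      using u lu by (simp add: powr_mult powr_add)
    also have "\<dots> \<le> C1 * (C * t powr e * L powr (e - 1)) powr (1 + \<theta>) * (B * L) powr \<theta>"
      using ut Bl[OF t u e ut] u lu \<theta> C1 by (intro mult_mono powr_mono2) (auto simp: L_def)
    also have "\<dots> = C1 * C powr (1 + \<theta>) * B powr \<theta> * (t powr (e * (1 + \<theta>)) * (L powr ((e - 1) * (1 + \<theta>)) * L powr \<theta>))"
      using C B L t' by (simp add: powr_mult powr_powr mult_ac)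
    also have "L powr ((e - 1) * (1 + \<theta>)) * L powr \<theta> = L powr (e * (1 + \<theta>) - 1)"
      by (simp add: algebra_simps flip: powr_add)
    also have "C1 * C powr (1 + \<theta>) * B powr \<theta> * (t powr (e * (1 + \<theta>)) * L powr (e * (1 + \<theta>) - 1))
        \<le> C' * (t powr (e * (1 + \<theta>)) * L powr (e * (1 + \<theta>) - 1))"
      unfolding C'_def using \<theta> C B C1 by (intro mult_right_mono mult_mono powr_mono) auto
    finally show ?thesis by (simp add: L_def mult.assoc)
  qed
  ultimately show ?thesis by (intro exI[of _ C']) auto
qed

context doubling_space
begin

text \<open>Norm at most \<open>W\<close> in the Beurling class with parameter \<infinity> and
  weight exponent \<open>d + s\<close>; \<open>W\<close> takes the place of the norm of A until the
  final theorem.\<close>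

definition decay :: "real \<Rightarrow> real \<Rightarrow> ('a \<Rightarrow> 'a \<Rightarrow> complex) \<Rightarrow> bool" where
  "decay s W A \<longleftrightarrow> (\<forall>x\<in>V. \<forall>y\<in>V. norm (A x y) \<le> W * real (\<rho> x y + 1) powr - (d + s))"

text \<open>Stability is tested on a unit vector: its p-norm is at least 1, and Schur's test bounds
  the p-norm of its image by a multiple of W, uniformly in p. The lower bound on W / Ap lets
  constants be absorbed into the logarithm, makes the scale N at least 1, and excludes matrices of
  norm 0.\<close>

lemma stability_ratio_lower_bound:
  assumes s: "s > 0" and V: "V \<noteq> {}"
  shows "\<exists>t0>0. \<forall>p A W Ap. 1 \<le> p \<longrightarrow> W > 0 \<longrightarrow> Ap > 0 \<longrightarrow> decay s W A \<longrightarrow> lp_stable V p A Ap \<longrightarrow> t0 \<le> W / Ap"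
proof -
  obtain C where C: "C > 0" and row: "\<And>N x. N \<ge> 1 \<Longrightarrow> x \<in> V \<Longrightarrow>
    (\<integral>\<^sup>+y. ennreal (real (\<rho> x y + 1) powr - (d + s) * min 1 (real (\<rho> x y + 1) / N)) \<partial>count_space V)
      \<le> ennreal (C * loss_rate s N)"
    using kernel_row_sum[OF s] by blast
  obtain z where z: "z \<in> V" using V by blast
  have "1 / (4 * C) \<le> W / Ap"
    if p: "1 \<le> p" and W: "W > 0" and Ap: "Ap > 0" and A: "decay s W A" and st: "lp_stable V p A Ap" for p A W Ap
  proof -
    define G where "G x y = W * real (\<rho> x y + 1) powr - (d + s)" for x y
    have G0: "G x y \<ge> 0" for x y using W by (simp add: G_def)
    have Gsym: "G x y = G y x" if "x \<in> V" "y \<in> V" for x y using dist_sym that by (simp add: G_def)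
    have Grow: "(\<integral>\<^sup>+y. ennreal (G x y) \<partial>count_space V) \<le> ennreal (W * C)" if x: "x \<in> V" for x
    proof -
      have "(\<integral>\<^sup>+y. ennreal (G x y) \<partial>count_space V)
         = ennreal W * (\<integral>\<^sup>+y. ennreal (real (\<rho> x y + 1) powr - (d + s) * min 1 (real (\<rho> x y + 1) / 1)) \<partial>count_space V)"
        using W by (subst nn_integral_cmult[symmetric]) (auto simp: G_def ennreal_mult intro!: nn_integral_cong)
      also have "\<dots> \<le> ennreal W * ennreal (C * loss_rate s 1)"
        using row[of 1, OF _ x] by (intro mult_left_mono) auto
      also have "\<dots> = ennreal (W * C)" using W C by (simp add: loss_rate_def flip: ennreal_mult)
      finally show ?thesis .
    qed
    define e where "e x = (if x = z then 1 else 0 :: complex)" for x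
    have "lp_norm V top e \<le> ennreal 1" by (subst lp_norm_top_le_iff) (auto simp: e_def)
    \<comment> \<open>The sup norm is transferred to p on a one-point support; the 2 is the loss of
      the change of exponent.\<close>
    then have "lp_norm V p e \<le> ennreal (2 * 1 powr max 0 (recip p - recip top) * 1)"
      using z p by (intro lp_norm_change_exponent[where S = "{z}"]) (auto simp: e_def)
    then have e2: "lp_norm V p e \<le> ennreal 2" by simp
    have "lp_norm V p (mat_apply V A e) \<le> ennreal (2 * (W * C) * 2)"
    proof (rule lp_norm_schur[OF p G0 Gsym Grow _ e2])
      fix x assume x: "x \<in> V"
      have le: "(\<integral>\<^sup>+y. ennreal (norm (A x y * e y)) \<partial>count_space V) \<le> (\<integral>\<^sup>+y. ennreal (G x y * norm (e y)) \<partial>count_space V)"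
        using A x by (intro nn_integral_mono ennreal_leI) (auto simp: norm_mult decay_def G_def intro!: mult_right_mono)
      also have "\<dots> \<le> (\<integral>\<^sup>+y. ennreal (G x y) \<partial>count_space V)"
        using G0 by (intro nn_integral_mono ennreal_leI) (auto simp: e_def)
      also have "\<dots> < \<infinity>" using Grow[OF x] by (rule order_le_less_trans) simp
      finally have "(\<integral>\<^sup>+y. ennreal (norm (A x y * e y)) \<partial>count_space V) < \<infinity>" .
      from infsum_norm_le_nn_integral(2)[OF this] le
      show "ennreal (norm (mat_apply V A e x)) \<le> (\<integral>\<^sup>+y. ennreal (G x y * norm (e y)) \<partial>count_space V)"
        unfolding mat_apply_def by (rule order_trans)
    qed (use W C in auto)
    moreover have "e \<in> lp_space V p" using e2 by (auto simp: lp_space_def intro: order_le_less_trans)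
    ultimately have *: "ennreal Ap * lp_norm V p e \<le> ennreal (4 * (W * C))"
      using st by (auto simp: lp_stable_def mult.commute intro: order_trans)
    obtain t where t: "lp_norm V p e = ennreal t" "t \<ge> 0"
      using e2 by (cases "lp_norm V p e" rule: ennreal_cases) (auto simp: top_unique)
    have "1 \<le> t" using norm_le_lp_norm[OF p _ t(2) z, of e] t by (simp add: e_def)
    have "ennreal (Ap * t) \<le> ennreal (4 * (W * C))" using * t Ap by (simp add: ennreal_mult)
    then have "Ap * t \<le> 4 * (W * C)" using W C by (simp add: ennreal_le_iff)
    moreover have "Ap * 1 \<le> Ap * t" using \<open>1 \<le> t\<close> Ap by (intro mult_left_mono) auto
    ultimately have "Ap \<le> W * (4 * C)" by linarith
    then show ?thesis using Ap C by (simp add: field_simps)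
  qed
  then show ?thesis using C by (intro exI[of _ "1 / (4 * C)"]) auto
qed

text \<open>Put t = W / Ap and \<delta> = |1/p - 1/q|. At scale N the ratio becomes t N^(d \<delta>)
  up to a constant, while absorption asks for N^\<gamma> of order t L(t) with \<gamma> = min(s, 1) -
  d \<delta>; hence the exponent d \<delta> / \<gamma>. The bound by \<delta>0 keeps \<gamma> away
  from 0, so that the constant is uniform.\<close>

lemma stability_step:
  assumes s: "s > 0" and V: "V \<noteq> {}" and \<delta>0: "0 \<le> \<delta>0" "\<delta>0 \<le> 1" "d * \<delta>0 < min s 1"
  shows "\<exists>C\<ge>1. \<forall>p q A W Ap. 1 \<le> p \<longrightarrow> 1 \<le> q \<longrightarrow> W > 0 \<longrightarrow> Ap > 0 \<longrightarrow> decay s W A \<longrightarrow>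
    lp_stable V p A Ap \<longrightarrow> \<bar>recip p - recip q\<bar> \<le> \<delta>0 \<longrightarrow>
    (\<exists>Aq>0. lp_stable V q A Aq \<and> W / Aq \<le> C * (W / Ap) * (W / Ap * log_factor s (W / Ap)) powr
       (d * \<bar>recip p - recip q\<bar> / (min s 1 - d * \<bar>recip p - recip q\<bar>)))"
proof -
  obtain C where C: "C > 0" and row: "\<And>N x. N \<ge> 1 \<Longrightarrow> x \<in> V \<Longrightarrow>
    (\<integral>\<^sup>+y. ennreal (real (\<rho> x y + 1) powr - (d + s) * min 1 (real (\<rho> x y + 1) / N)) \<partial>count_space V)
      \<le> ennreal (C * loss_rate s N)"
    using kernel_row_sum[OF s] by blast
  obtain t0 where t0: "t0 > 0" and t0_le: "\<And>p A W Ap. 1 \<le> p \<Longrightarrow> W > 0 \<Longrightarrow> Ap > 0 \<Longrightarrow> decay s W A \<Longrightarrow>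
      lp_stable V p A Ap \<Longrightarrow> t0 \<le> W / Ap"
    using stability_ratio_lower_bound[OF s V] by blast
  \<comment> \<open>The constants of \<open>stability_inequality\<close>, with 4 N + 1 \<le> 5
    N.\<close>
  define B where "B = D0 ^ 4 * 48 * (D1 * 5 powr d)"
  have D5: "D1 * 5 powr d \<ge> 1"
    using D1 d ge_one_powr_ge_zero[of 5 d] mult_mono[of 1 D1 1 "5 powr d"] by simp
  moreover have "D0 ^ 4 * 48 \<ge> 1" using one_le_power[OF D0, of 4] by linarith
  ultimately have B: "B \<ge> 1"
    unfolding B_def using mult_mono[of 1 "D0 ^ 4 * 48" 1 "D1 * 5 powr d"] by simp
  define \<gamma>0 where "\<gamma>0 = min s 1 - d * \<delta>0"
  have \<gamma>0: "\<gamma>0 > 0" using \<delta>0 by (simp add: \<gamma>0_def)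
  \<comment> \<open>96 is twice the 48 in front of \<kappa> in \<open>stability_inequality\<close>,
    so that the error term becomes at most half the norm of c.\<close>
  have "B * 96 * C > 0" using B C by simp
  from choose_scale[OF this \<gamma>0 t0, of s]
  obtain E' where E': "E' \<ge> 1" and scale: "\<And>\<gamma> t. \<gamma>0 \<le> \<gamma> \<Longrightarrow> t0 \<le> t \<Longrightarrow>
    (\<exists>N\<ge>1. B * 96 * C * t * (N powr - \<gamma> * (if s = 1 then 1 + ln N else 1)) \<le> 1
      \<and> N powr \<gamma> = E' * (t * log_factor s t))"
    by blast
  define \<theta>m where "\<theta>m = d * \<delta>0 / \<gamma>0"
  have \<theta>m: "\<theta>m \<ge> 0" using d \<delta>0 \<gamma>0 by (simp add: \<theta>m_def)
  define C1 where "C1 = 8 * B * E' powr \<theta>m"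
  have C1: "C1 \<ge> 1"
    unfolding C1_def using B ge_one_powr_ge_zero[OF E' \<theta>m] mult_mono[of 1 "8 * B" 1 "E' powr \<theta>m"] by simp
  have "\<exists>Aq>0. lp_stable V q A Aq \<and> W / Aq \<le> C1 * (W / Ap) * (W / Ap * log_factor s (W / Ap)) powr
       (d * \<bar>recip p - recip q\<bar> / (min s 1 - d * \<bar>recip p - recip q\<bar>))"
    if p: "1 \<le> p" and q: "1 \<le> q" and W: "W > 0" and Ap: "Ap > 0" and A: "decay s W A"
      and st: "lp_stable V p A Ap" and \<delta>: "\<bar>recip p - recip q\<bar> \<le> \<delta>0" for p q A W Ap
  proof -
    define \<delta> where "\<delta> = \<bar>recip p - recip q\<bar>"
    have \<delta>': "0 \<le> \<delta>" "\<delta> \<le> \<delta>0" using \<delta> by (auto simp: \<delta>_def)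
    define \<gamma> where "\<gamma> = min s 1 - d * \<delta>"
    define \<theta> where "\<theta> = d * \<delta> / \<gamma>"
    have \<gamma>: "\<gamma>0 \<le> \<gamma>" unfolding \<gamma>_def \<gamma>0_def using \<delta>' d by (simp add: mult_left_mono)
    have \<theta>: "0 \<le> \<theta>" "\<theta> \<le> \<theta>m"
      unfolding \<theta>_def \<theta>m_def using \<delta>' d \<gamma> \<gamma>0 by (auto intro!: frac_le mult_left_mono)
    define t where "t = W / Ap"
    have t: "t0 \<le> t" unfolding t_def by (rule t0_le[OF p W Ap A st])
    with t0 have t': "t > 0" by simp
    obtain N where N: "N \<ge> 1" and N1: "B * 96 * C * t * (N powr - \<gamma> * (if s = 1 then 1 + ln N else 1)) \<le> 1"
      and N2: "N powr \<gamma> = E' * (t * log_factor s t)"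
      using scale[OF \<gamma> t] by blast
    define k where "k n = W * real (n + 1) powr - (d + s)" for n :: nat
    define \<kappa> where "\<kappa> = W * C * loss_rate s N"
    have \<kappa>: "\<kappa> > 0"
    proof -
      have "loss_rate s N > 0" using N by (auto simp: loss_rate_def add_pos_nonneg)
      then show ?thesis using W C by (simp add: \<kappa>_def)
    qed
    have krow: "(\<integral>\<^sup>+y. ennreal (k (\<rho> x y) * min 1 (real (\<rho> x y + 1) / N')) \<partial>count_space V)
        \<le> ennreal (W * C * loss_rate s N')" if N': "N' \<ge> 1" and x: "x \<in> V" for N' x
    proof -
      have "(\<integral>\<^sup>+y. ennreal (k (\<rho> x y) * min 1 (real (\<rho> x y + 1) / N')) \<partial>count_space V)
        = ennreal W * (\<integral>\<^sup>+y. ennreal (real (\<rho> x y + 1) powr - (d + s) * min 1 (real (\<rho> x y + 1) / N')) \<partial>count_space V)"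
        using W N' by (subst nn_integral_cmult[symmetric])
          (auto simp: k_def mult.assoc ennreal_mult' intro!: nn_integral_cong)
      also have "\<dots> \<le> ennreal W * ennreal (C * loss_rate s N')"
        using row[OF N' x] by (intro mult_left_mono) auto
      also have "\<dots> = ennreal (W * C * loss_rate s N')"
        using W by (simp add: ennreal_mult' mult.assoc)
      finally show ?thesis .
    qed
    have krow1: "(\<integral>\<^sup>+y. ennreal (k (\<rho> x y)) \<partial>count_space V) < \<infinity>" if x: "x \<in> V" for x
    proof -
      have "(\<integral>\<^sup>+y. ennreal (k (\<rho> x y)) \<partial>count_space V)
         = (\<integral>\<^sup>+y. ennreal (k (\<rho> x y) * min 1 (real (\<rho> x y + 1) / 1)) \<partial>count_space V)"
        by (intro nn_integral_cong) simp
      also have "\<dots> \<le> ennreal (W * C * loss_rate s 1)" using x by (intro krow) auto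
      also have "\<dots> < \<infinity>" by simp
      finally show ?thesis .
    qed
    define Z where "Z = B * N powr (d * \<delta>) / Ap"
    have Z: "Z > 0" using B N Ap by (simp add: Z_def)
    have absorb: "Z * (48 * \<kappa>) \<le> 1 / 2"
    proof -
      have "N powr (d * \<delta>) * N powr - min s 1 = N powr - \<gamma>"
        by (simp add: \<gamma>_def flip: powr_add)
      then have "Z * (96 * \<kappa>) = B * 96 * C * t * (N powr - \<gamma> * (if s = 1 then 1 + ln N else 1))"
        by (simp add: Z_def \<kappa>_def loss_rate_def t_def mult_ac)
      with N1 show ?thesis by linarith
    qed
    \<comment> \<open>From X \<le> 4 Z Y + X / 2 follows X \<le> 8 Z Y; X may be subtracted because
      it is finite for c in the space.\<close>
    define Aq where "Aq = 1 / (8 * Z)"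
    have Aq: "Aq > 0" using Z by (simp add: Aq_def)
    have "lp_stable V q A Aq"
      unfolding lp_stable_def
    proof
      fix c assume "c \<in> lp_space V q"
      then obtain X where X: "lp_norm V q c = ennreal X" "X \<ge> 0"
        by (cases "lp_norm V q c" rule: ennreal_cases) (auto simp: lp_space_def)
      show "ennreal Aq * lp_norm V q c \<le> lp_norm V q (mat_apply V A c)"
      proof (cases "lp_norm V q (mat_apply V A c)" rule: ennreal_cases)
        case (real Y)
        have "lp_norm V q c \<le> ennreal (D0 ^ 4 *
            (48 * (D1 * (4 * N + 1) powr d) powr \<delta> / Ap) * (4 * Y + 48 * \<kappa> * X))"
          unfolding \<delta>_def
          by (rule stability_inequality[where k = k and A = A, OF p q N _ _ krow1 krow[OF N, folded \<kappa>_def] \<kappa> st Ap])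
            (use A W X real in \<open>auto simp: decay_def k_def\<close>)
        then have "X \<le> D0 ^ 4 * (48 * (D1 * (4 * N + 1) powr d) powr \<delta> / Ap) * (4 * Y + 48 * \<kappa> * X)"
          unfolding X(1) using D0 X real \<kappa> Ap by (subst (asm) ennreal_le_iff) auto
        also have "\<dots> \<le> Z * (4 * Y + 48 * \<kappa> * X)"
        proof (rule mult_right_mono)
          have "(D1 * (4 * N + 1) powr d) powr \<delta> \<le> (D1 * (5 * N) powr d) powr \<delta>"
            using N D1 d \<delta>' by (intro powr_mono2 mult_left_mono) auto
          also have "\<dots> = (D1 * 5 powr d) powr \<delta> * N powr (d * \<delta>)"
            using N D1 by (simp add: powr_mult powr_powr)
          also have "\<dots> \<le> (D1 * 5 powr d) powr 1 * N powr (d * \<delta>)"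
            using \<delta>' \<delta>0 D5 by (intro mult_right_mono powr_mono) auto
          finally have "(D1 * (4 * N + 1) powr d) powr \<delta> \<le> D1 * 5 powr d * N powr (d * \<delta>)"
            using D1 by simp
          then have "D0 ^ 4 * (48 * (D1 * (4 * N + 1) powr d) powr \<delta> / Ap)
              \<le> D0 ^ 4 * (48 * (D1 * 5 powr d * N powr (d * \<delta>)) / Ap)"
            using D0 Ap by (intro mult_left_mono divide_right_mono) auto
          then show "D0 ^ 4 * (48 * (D1 * (4 * N + 1) powr d) powr \<delta> / Ap) \<le> Z"
            by (simp add: Z_def B_def mult_ac)
        qed (use X real \<kappa> in simp)
        also have "\<dots> = 4 * Z * Y + Z * (48 * \<kappa>) * X" by (simp add: algebra_simps)
        also have "\<dots> \<le> 4 * Z * Y + 1 / 2 * X"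
          using absorb X by (intro add_left_mono mult_right_mono) auto
        finally have "Aq * X \<le> Y" using Z by (simp add: Aq_def field_simps)
        then show ?thesis using X real Aq by (simp add: ennreal_leI flip: ennreal_mult)
      qed simp
    qed
    moreover have "W / Aq \<le> C1 * t * (t * log_factor s t) powr \<theta>"
    proof -
      have "W / Aq = 8 * B * t * N powr (d * \<delta>)" by (simp add: Aq_def Z_def t_def)
      also have "N powr (d * \<delta>) = (N powr \<gamma>) powr \<theta>"
        using \<gamma> \<gamma>0 by (simp add: powr_powr \<theta>_def)
      also have "\<dots> = E' powr \<theta> * (t * log_factor s t) powr \<theta>"
        unfolding N2 using E' t' log_factor_pos[OF t'] by (simp add: powr_mult)
      also have "8 * B * t * (E' powr \<theta> * (t * log_factor s t) powr \<theta>)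
          \<le> 8 * B * t * (E' powr \<theta>m * (t * log_factor s t) powr \<theta>)"
        using B t' E' \<theta> by (intro mult_left_mono mult_right_mono powr_mono) auto
      finally show ?thesis by (simp add: C1_def mult_ac)
    qed
    ultimately show ?thesis using Aq unfolding t_def \<theta>_def \<gamma>_def \<delta>_def by blast
  qed
  with C1 show ?thesis by blast
qed

subsection \<open>Iteration\<close>

text \<open>A common \<theta> for all steps makes the accumulated exponent a pure power of 1 +
  \<theta>. The sequence is total, but beyond index K0 its entries may be any exponents.\<close>

definition uniform_chain :: "real \<Rightarrow> nat \<Rightarrow> real \<Rightarrow> (nat \<Rightarrow> ennreal) \<Rightarrow> bool" where
  "uniform_chain s K0 \<theta> e \<longleftrightarrow> (\<forall>i. 1 \<le> e i) \<and> 0 \<le> \<theta> \<and>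
    (\<forall>i<K0. \<bar>recip (e i) - recip (e (Suc i))\<bar> \<le> 1 / K0 \<and>
       d * \<bar>recip (e i) - recip (e (Suc i))\<bar> / (min s 1 - d * \<bar>recip (e i) - recip (e (Suc i))\<bar>) = \<theta>)"

text \<open>Induction on the number of steps with \<open>iterate_ratio_bound\<close>. The constant
  can be chosen before A, \<theta> and the chain: steps have length at most 1 / K0, so \<theta> is
  at most its value for that length, which is finite by
  \<open>d / real K0 < min s 1\<close>.\<close>

lemma stability_chain:
  assumes s: "s > 0" and V: "V \<noteq> {}" and K0: "K0 > 0" and dK: "d / real K0 < min s 1" and n: "n \<le> K0"
  shows "\<exists>C\<ge>1. \<forall>A W Ap \<theta> e. W > 0 \<longrightarrow> Ap > 0 \<longrightarrow> decay s W A \<longrightarrow> uniform_chain s K0 \<theta> e \<longrightarrow>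
    lp_stable V (e 0) A Ap \<longrightarrow>
    (\<exists>Aq>0. lp_stable V (e n) A Aq \<and>
      W / Aq \<le> C * (W / Ap) powr ((1 + \<theta>) ^ n) * log_factor s (W / Ap) powr ((1 + \<theta>) ^ n - 1))"
  using n
proof (induction n)
  case 0
  show ?case
  proof (rule exI[of _ 1], intro conjI allI impI)
    fix A :: "'a \<Rightarrow> 'a \<Rightarrow> complex" and W Ap \<theta> :: real and e :: "nat \<Rightarrow> ennreal"
    assume "W > 0" "Ap > 0" "lp_stable V (e 0) A Ap"
    \<comment> \<open>\<open>0 powr 0\<close> is 0, so the last factor equals 1 only because its
      base is positive.\<close>
    moreover from this have "log_factor s (W / Ap) > 0" by (intro log_factor_pos) simp
    ultimately show "\<exists>Aq>0. lp_stable V (e 0) A Aq \<and>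
      W / Aq \<le> 1 * (W / Ap) powr ((1 + \<theta>) ^ 0) * log_factor s (W / Ap) powr ((1 + \<theta>) ^ 0 - 1)"
      by (intro exI[of _ Ap]) simp
  qed simp
next
  case (Suc n)
  then have nK: "n < K0" by simp
  from Suc.IH[OF less_imp_le[OF nK]] obtain C where C: "C \<ge> 1"
    and IH: "\<forall>A W Ap \<theta> e. W > 0 \<longrightarrow> Ap > 0 \<longrightarrow> decay s W A \<longrightarrow> uniform_chain s K0 \<theta> e \<longrightarrow>
    lp_stable V (e 0) A Ap \<longrightarrow>
    (\<exists>Aq>0. lp_stable V (e n) A Aq \<and>
      W / Aq \<le> C * (W / Ap) powr ((1 + \<theta>) ^ n) * log_factor s (W / Ap) powr ((1 + \<theta>) ^ n - 1))"
    by (elim exE conjE)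
  define \<delta>0 where "\<delta>0 = 1 / real K0"
  have \<delta>0: "0 \<le> \<delta>0" "\<delta>0 \<le> 1" "d * \<delta>0 < min s 1" using K0 dK by (auto simp: \<delta>0_def)
  define \<theta>m where "\<theta>m = d * \<delta>0 / (min s 1 - d * \<delta>0)"
  have \<theta>m: "\<theta>m \<ge> 0" using d \<delta>0 by (simp add: \<theta>m_def)
  obtain C1 where C1: "C1 \<ge> 1" and step: "\<And>p q A W Ap. 1 \<le> p \<Longrightarrow> 1 \<le> q \<Longrightarrow> W > 0 \<Longrightarrow> Ap > 0 \<Longrightarrow> decay s W A \<Longrightarrow>
    lp_stable V p A Ap \<Longrightarrow> \<bar>recip p - recip q\<bar> \<le> \<delta>0 \<Longrightarrow>
    (\<exists>Aq>0. lp_stable V q A Aq \<and> W / Aq \<le> C1 * (W / Ap) * (W / Ap * log_factor s (W / Ap)) powr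
       (d * \<bar>recip p - recip q\<bar> / (min s 1 - d * \<bar>recip p - recip q\<bar>)))"
    using stability_step[OF s V \<delta>0] by blast
  obtain t0 where t0: "t0 > 0" and t0_le: "\<And>p A W Ap. 1 \<le> p \<Longrightarrow> W > 0 \<Longrightarrow> Ap > 0 \<Longrightarrow> decay s W A \<Longrightarrow>
      lp_stable V p A Ap \<Longrightarrow> t0 \<le> W / Ap"
    using stability_ratio_lower_bound[OF s V] by blast
  have M: "(1 + \<theta>m) ^ n \<ge> 1" using \<theta>m by (simp add: one_le_power)
  obtain C' where C': "C' \<ge> 1" and iter: "\<And>t u e \<theta>. t0 \<le> t \<Longrightarrow> 0 < u \<Longrightarrow> 1 \<le> e \<Longrightarrow> e \<le> (1 + \<theta>m) ^ n \<Longrightarrow>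
    0 \<le> \<theta> \<Longrightarrow> \<theta> \<le> \<theta>m \<Longrightarrow> u \<le> C * t powr e * log_factor s t powr (e - 1) \<Longrightarrow>
    C1 * u * (u * log_factor s u) powr \<theta>
      \<le> C' * t powr (e * (1 + \<theta>)) * log_factor s t powr (e * (1 + \<theta>) - 1)"
    using iterate_ratio_bound[OF t0 C C1 M \<theta>m] by blast
  show ?case
  proof (rule exI[of _ C'], intro conjI allI impI C')
    fix A :: "'a \<Rightarrow> 'a \<Rightarrow> complex" and W Ap \<theta> :: real and e :: "nat \<Rightarrow> ennreal"
    assume W: "W > 0" and Ap: "Ap > 0" and A: "decay s W A" and chain: "uniform_chain s K0 \<theta> e"
      and st: "lp_stable V (e 0) A Ap"
    have e: "\<forall>i. 1 \<le> e i" and \<theta>0: "0 \<le> \<theta>" using chain by (auto simp: uniform_chain_def)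
    from IH[rule_format, OF W Ap A chain st] obtain An where An: "An > 0" "lp_stable V (e n) A An"
      and An_le: "W / An \<le> C * (W / Ap) powr ((1 + \<theta>) ^ n) * log_factor s (W / Ap) powr ((1 + \<theta>) ^ n - 1)"
      by blast
    define \<delta> where "\<delta> = \<bar>recip (e n) - recip (e (Suc n))\<bar>"
    have \<delta>: "\<delta> \<le> \<delta>0" "0 \<le> \<delta>" and \<theta>_eq: "d * \<delta> / (min s 1 - d * \<delta>) = \<theta>"
      using chain nK by (auto simp: uniform_chain_def \<delta>_def \<delta>0_def)
    have "d * \<delta> \<le> d * \<delta>0" using \<delta> d by (intro mult_left_mono) auto
    then have \<theta>_le: "\<theta> \<le> \<theta>m"
      unfolding \<theta>_eq[symmetric] \<theta>m_def using \<delta> \<delta>0 d by (intro frac_le) auto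
    from step[OF _ _ W An(1) A An(2), of "e (Suc n)"] e \<delta>(1)
    obtain Aq where Aq: "Aq > 0" "lp_stable V (e (Suc n)) A Aq"
      and Aq_le: "W / Aq \<le> C1 * (W / An) * (W / An * log_factor s (W / An)) powr \<theta>"
      unfolding \<delta>_def[symmetric] \<theta>_eq by blast
    note Aq_le
    also have "C1 * (W / An) * (W / An * log_factor s (W / An)) powr \<theta>
       \<le> C' * (W / Ap) powr ((1 + \<theta>) ^ n * (1 + \<theta>)) * log_factor s (W / Ap) powr ((1 + \<theta>) ^ n * (1 + \<theta>) - 1)"
      using t0_le[OF _ W Ap A st] e W An(1) \<theta>0 \<theta>_le An_le
      by (intro iter) (auto intro: power_mono one_le_power)
    finally show "\<exists>Aq>0. lp_stable V (e (Suc n)) A Aq \<and>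
      W / Aq \<le> C' * (W / Ap) powr ((1 + \<theta>) ^ Suc n) * log_factor s (W / Ap) powr ((1 + \<theta>) ^ Suc n - 1)"
      using Aq by (auto simp: mult.commute)
  qed
qed

text \<open>The reciprocals are interpolated linearly in K0 steps. The chain yields t^E L^(E-1) with
  t = W / Ap and L = \<open>log_factor s t\<close>; as L is bounded below, L^(E-1) is at most a
  constant times L^E, and t and L combine into one power.\<close>

lemma stability_transfer:
  assumes s: "s > 0" and V: "V \<noteq> {}" and K0: "K0 > 0" and dK: "d / real K0 < min s 1"
  shows "\<exists>C\<ge>1. \<forall>p q A W Ap. 1 \<le> p \<longrightarrow> 1 \<le> q \<longrightarrow> W > 0 \<longrightarrow> Ap > 0 \<longrightarrow> decay s W A \<longrightarrow> lp_stable V p A Ap \<longrightarrow>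
    (\<exists>Aq>0. lp_stable V q A Aq \<and>
      W / Aq \<le> C * (W / Ap * log_factor s (W / Ap)) powr
        ((1 + d * \<bar>recip p - recip q\<bar> / (real K0 * min s 1 - d * \<bar>recip p - recip q\<bar>)) ^ K0))"
proof -
  obtain C where C: "C \<ge> 1" and chain: "\<And>A W Ap \<theta> e. W > 0 \<Longrightarrow> Ap > 0 \<Longrightarrow> decay s W A \<Longrightarrow>
    uniform_chain s K0 \<theta> e \<Longrightarrow>
    lp_stable V (e 0) A Ap \<Longrightarrow>
    (\<exists>Aq>0. lp_stable V (e K0) A Aq \<and>
      W / Aq \<le> C * (W / Ap) powr ((1 + \<theta>) ^ K0) * log_factor s (W / Ap) powr ((1 + \<theta>) ^ K0 - 1))"
    using stability_chain[OF s V K0 dK order_refl] by blast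
  obtain t0 where t0: "t0 > 0" and t0_le: "\<And>p A W Ap. 1 \<le> p \<Longrightarrow> W > 0 \<Longrightarrow> Ap > 0 \<Longrightarrow> decay s W A \<Longrightarrow>
      lp_stable V p A Ap \<Longrightarrow> t0 \<le> W / Ap"
    using stability_ratio_lower_bound[OF s V] by blast
  define L0 where "L0 = log_factor s t0"
  have L0: "L0 > 0" unfolding L0_def using t0 by (rule log_factor_pos)
  define C' where "C' = max 1 (C / L0)"
  have "\<exists>Aq>0. lp_stable V q A Aq \<and>
      W / Aq \<le> C' * (W / Ap * log_factor s (W / Ap)) powr
        ((1 + d * \<bar>recip p - recip q\<bar> / (real K0 * min s 1 - d * \<bar>recip p - recip q\<bar>)) ^ K0)"
    if p: "1 \<le> p" and q: "1 \<le> q" and W: "W > 0" and Ap: "Ap > 0" and A: "decay s W A"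
      and st: "lp_stable V p A Ap" for p q A W Ap
  proof -
    define \<theta> where "\<theta> = d * \<bar>recip p - recip q\<bar> / (real K0 * min s 1 - d * \<bar>recip p - recip q\<bar>)"
    define \<tau> where "\<tau> i = recip p + real i / real K0 * (recip q - recip p)" for i
    have "\<exists>x\<ge>1. i \<le> K0 \<longrightarrow> recip x = \<tau> i" for i
    proof (cases "i \<le> K0")
      case True
      define l where "l = real i / real K0"
      have l: "0 \<le> l" "l \<le> 1" using True K0 by (auto simp: l_def)
      have \<tau>: "\<tau> i = (1 - l) * recip p + l * recip q" by (simp add: \<tau>_def l_def[symmetric] algebra_simps)
      have "0 \<le> \<tau> i" unfolding \<tau> using l recip_bounds[OF p] recip_bounds[OF q] by (intro add_nonneg_nonneg mult_nonneg_nonneg) auto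
      moreover have "\<tau> i \<le> 1" unfolding \<tau> using l recip_bounds[OF p] recip_bounds[OF q] by (intro convex_bound_le) auto
      ultimately show ?thesis using ex_recip by blast
    qed auto
    then obtain e where e: "\<And>i. 1 \<le> e i" "\<And>i. i \<le> K0 \<Longrightarrow> recip (e i) = \<tau> i" by metis
    have e0: "e 0 = p" and eK: "e K0 = q"
      using e p q K0 by (auto intro!: recip_inject simp: \<tau>_def)
    define D where "D = \<bar>recip p - recip q\<bar>"
    have D: "0 \<le> D" "D \<le> 1" using recip_bounds[OF p] recip_bounds[OF q] by (auto simp: D_def)
    have ei: "\<bar>recip (e i) - recip (e (Suc i))\<bar> = D / K0" if "i < K0" for i
    proof -
      have "recip (e i) - recip (e (Suc i)) = (recip p - recip q) / K0"
      proof -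
        have "recip (e i) = \<tau> i" "recip (e (Suc i)) = \<tau> (Suc i)" using that e by auto
        then show ?thesis
          by (simp add: \<tau>_def add_divide_distrib diff_divide_distrib algebra_simps)
      qed
      then show ?thesis by (simp add: D_def abs_divide)
    qed
    have "d * D \<le> d" using D d by (simp add: mult_left_le)
    also have "d < min s 1 * real K0" using dK K0 by (simp only: pos_divide_less_eq of_nat_0_less_iff)
    also have "\<dots> = real K0 * min s 1" by (rule mult.commute)
    finally have pos: "real K0 * min s 1 - d * D > 0" by simp
    have \<theta>0: "\<theta> \<ge> 0" unfolding \<theta>_def D_def[symmetric] using pos D d by simp
    \<comment> \<open>A step of length D / K0 has exactly the exponent \<theta>(p,q) of the theorem,
      after expanding the fraction by K0.\<close>
    have \<theta>_eq: "d * (D / K0) / (min s 1 - d * (D / K0)) = \<theta>"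
    proof -
      have "min s 1 - d * (D / K0) = (real K0 * min s 1 - d * D) / K0"
        using K0 by (simp add: diff_divide_distrib)
      then show ?thesis using K0 by (simp add: \<theta>_def D_def)
    qed
    have "uniform_chain s K0 \<theta> e"
      unfolding uniform_chain_def using D e(1) \<theta>0 \<theta>_eq by (simp add: ei divide_right_mono)
    from chain[OF W Ap A this] st e0 eK
    obtain Aq where Aq: "Aq > 0" "lp_stable V q A Aq"
      and le: "W / Aq \<le> C * (W / Ap) powr ((1 + \<theta>) ^ K0) * log_factor s (W / Ap) powr ((1 + \<theta>) ^ K0 - 1)"
      by auto
    define t where "t = W / Ap"
    have t: "t0 \<le> t" unfolding t_def by (rule t0_le[OF p W Ap A st])
    have L: "L0 \<le> log_factor s t" unfolding L0_def using t0 t by (rule log_factor_mono)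
    define E where "E = (1 + \<theta>) ^ K0"
    have "log_factor s t powr (E - 1) = log_factor s t powr E / log_factor s t"
      using L L0 by (simp add: powr_diff)
    also have "\<dots> \<le> log_factor s t powr E / L0"
      using L L0 by (intro divide_left_mono) auto
    finally have "C * t powr E * log_factor s t powr (E - 1) \<le> C * t powr E * (log_factor s t powr E / L0)"
      using C by (intro mult_left_mono) auto
    also have "\<dots> = C / L0 * (t * log_factor s t) powr E"
      using t t0 L L0 by (simp add: powr_mult)
    also have "\<dots> \<le> C' * (t * log_factor s t) powr E"
      unfolding C'_def by (intro mult_right_mono) auto
    finally have "W / Aq \<le> C' * (t * log_factor s t) powr E"
      using le unfolding t_def E_def by linarith
    with Aq show ?thesis unfolding t_def E_def \<theta>_def by blast
  qed
  moreover have "C' \<ge> 1" by (simp add: C'_def)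
  ultimately show ?thesis by blast
qed

end

subsection \<open>Graphs and Beurling classes\<close>

text \<open>For u \<le> 1 every summand is at least the last one; for u > 1 the mean value theorem
  bounds each increment of the left side by u times the new summand. The sum is the total weight of
  the indices up to n in the Beurling norm.\<close>

lemma sum_powr_ge:
  fixes u :: real
  assumes u: "u > 0"
  shows "real (n + 1) powr u \<le> max 1 u * (\<Sum>k\<le>n. real (k + 1) powr (u - 1))"
proof (cases "u \<le> 1")
  case True
  have "real (n + 1) powr u = (\<Sum>k\<le>n. real (n + 1) powr (u - 1))"
    by (simp add: powr_diff)
  also have "\<dots> \<le> (\<Sum>k\<le>n. real (k + 1) powr (u - 1))"
    using True by (intro sum_mono powr_mono2') auto
  finally show ?thesis using True by (simp add: max_def)
next
  case False
  then have u1: "u > 1" by simp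
  show ?thesis
  proof (induction n)
    case 0
    then show ?case using u1 by simp
  next
    case (Suc n)
    have "\<exists>z>real (n + 1). z < real (n + 2) \<and>
        real (n + 2) powr u - real (n + 1) powr u = (real (n + 2) - real (n + 1)) * (u * z powr (u - 1))"
      by (rule MVT2) (auto intro!: derivative_eq_intros)
    then obtain z where z: "real (n + 1) < z" "z < real (n + 2)"
      "real (n + 2) powr u - real (n + 1) powr u = u * z powr (u - 1)" by auto
    have "u * z powr (u - 1) \<le> u * real (n + 2) powr (u - 1)"
      using z u1 by (intro mult_left_mono powr_mono2) auto
    moreover have "max 1 u = u" using u1 by simp
    ultimately have "real (n + 2) powr u
        \<le> u * (\<Sum>k\<le>n. real (k + 1) powr (u - 1)) + u * real (n + 2) powr (u - 1)"
      using z(3) Suc by (simp only:)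
    also have "\<dots> = u * (\<Sum>k\<le>Suc n. real (k + 1) powr (u - 1))"
      by (simp add: distrib_left add.commute)
    finally show ?case using u1 by simp
  qed
qed

lemma ennreal_powr_mono: "s > 0 \<Longrightarrow> x \<le> y \<Longrightarrow> ennreal_powr x s \<le> ennreal_powr y s"
  by (cases x rule: ennreal_cases; cases y rule: ennreal_cases)
    (auto simp: ennreal_powr_def top_unique intro!: ennreal_leI powr_mono2)

text \<open>The weighted \<open>r\<close>-norm of the nonincreasing sequence \<open>offdiag_sup\<close> controls the weighted
  supremum: \<open>B\<^sub>r\<^sub>,\<^sub>\<alpha>\<close> embeds into \<open>B\<^sub>\<infinity>\<^sub>,\<^sub>\<beta>\<close> with \<open>\<beta> = \<alpha> + d / r\<close>.\<close>
lemma beurling_class_entry_bound: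
  assumes r: "1 \<le> r" and d: "d > 0" and \<alpha>: "\<alpha> > 0"
  shows "\<exists>C\<ge>1. \<forall>A\<in>beurling_class V E d r \<alpha>. \<forall>x\<in>V. \<forall>y\<in>V.
    norm (A x y) \<le> C * enn2real (beurling_norm V E d r \<alpha> A)
      * real (geodesic_dist E x y + 1) powr - (\<alpha> + d * recip r)"
proof -
  \<comment> \<open>\<open>u - 1\<close> is the weight exponent of the norm for finite r, so the
    weights up to n add up to order (n+1)^u, and u / r = \<alpha> + d / r. For
    \<open>r = \<infinity>\<close> only \<open>max 1 u \<ge> 1\<close> is used.\<close>
  define u where "u = \<alpha> * enn2real r + d"
  have "norm (A x y) \<le> max 1 u * enn2real (beurling_norm V E d r \<alpha> A)
      * real (geodesic_dist E x y + 1) powr - (\<alpha> + d * recip r)"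
    if A: "A \<in> beurling_class V E d r \<alpha>" and x: "x \<in> V" and y: "y \<in> V" for A x y
  proof -
    define B where "B = enn2real (beurling_norm V E d r \<alpha> A)"
    have B: "beurling_norm V E d r \<alpha> A = ennreal B" "B \<ge> 0"
      using A by (auto simp: B_def beurling_class_def)
    define a where "a = norm (A x y)"
    define n where "n = geodesic_dist E x y"
    \<comment> \<open>A single entry at distance n bounds all values with index k \<le> n from
      below; this is what makes the weights accumulate.\<close>
    have off: "ennreal a \<le> offdiag_sup V E A k" if "k \<le> n" for k
      unfolding offdiag_sup_def a_def
      by (rule SUP_upper2[of "(x, y)"]) (use x y that in \<open>auto simp: n_def\<close>)
    show ?thesis
    proof (cases "r = \<infinity>")
      case True
      have "ennreal (a * real (n + 1) powr \<alpha>) \<le> offdiag_sup V E A n * ennreal (real (n + 1) powr \<alpha>)"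
        using off[of n] by (simp add: ennreal_mult a_def mult_right_mono)
      also have "\<dots> \<le> (SUP n. offdiag_sup V E A n * ennreal (real (n + 1) powr \<alpha>))"
        by (rule SUP_upper) simp
      also have "\<dots> = ennreal B" using B True by (simp add: beurling_norm_def)
      finally have "a * real (n + 1) powr \<alpha> \<le> B" using B by (simp add: ennreal_le_iff)
      then have "a \<le> B * real (n + 1) powr - \<alpha>" by (simp add: powr_minus field_simps)
      also have "\<dots> \<le> max 1 u * B * real (n + 1) powr - \<alpha>"
        using B(2) mult_right_mono[of 1 "max 1 u" B] by (intro mult_right_mono) auto
      finally show ?thesis using True by (simp add: a_def n_def B_def)
    next
      case False
      define R where "R = enn2real r"
      have R: "R \<ge> 1" using enn2real_ge_1[OF r False] by (simp add: R_def)
      have u: "u > 0" using \<alpha> R d by (simp add: u_def R_def[symmetric] add_nonneg_pos)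
      have "ennreal_powr (\<Sum>n. ennreal_powr (offdiag_sup V E A n) R * ennreal (real (n + 1) powr (u - 1))) (1 / R)
          \<le> ennreal B"
        using B False by (simp add: beurling_norm_def R_def u_def)
      then have sum: "(\<Sum>n. ennreal_powr (offdiag_sup V E A n) R * ennreal (real (n + 1) powr (u - 1)))
          \<le> ennreal (B powr R)"
        using R B by (subst (asm) ennreal_powr_le_iff) auto
      have "ennreal (a powr R * (\<Sum>k\<le>n. real (k + 1) powr (u - 1)))
          = (\<Sum>k\<le>n. ennreal (a powr R) * ennreal (real (k + 1) powr (u - 1)))"
        by (simp add: sum_distrib_left sum_ennreal flip: ennreal_mult)
      also have "\<dots> \<le> (\<Sum>k\<le>n. ennreal_powr (offdiag_sup V E A k) R * ennreal (real (k + 1) powr (u - 1)))"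
      proof (intro sum_mono mult_right_mono)
        fix k assume "k \<in> {..n}"
        then have "ennreal_powr (ennreal a) R \<le> ennreal_powr (offdiag_sup V E A k) R"
          using off R by (intro ennreal_powr_mono) auto
        then show "ennreal (a powr R) \<le> ennreal_powr (offdiag_sup V E A k) R"
          by (simp add: ennreal_powr_def a_def)
      qed simp
      also have "\<dots> \<le> (\<Sum>n. ennreal_powr (offdiag_sup V E A n) R * ennreal (real (n + 1) powr (u - 1)))"
        by (rule sum_le_suminf) auto
      also note sum
      finally have S: "a powr R * (\<Sum>k\<le>n. real (k + 1) powr (u - 1)) \<le> B powr R"
        by (simp add: ennreal_le_iff)
      have "a powr R * real (n + 1) powr u \<le> a powr R * (max 1 u * (\<Sum>k\<le>n. real (k + 1) powr (u - 1)))"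
        using sum_powr_ge[OF u, of n] by (intro mult_left_mono) auto
      also have "\<dots> = max 1 u * (a powr R * (\<Sum>k\<le>n. real (k + 1) powr (u - 1)))" by simp
      also have "\<dots> \<le> max 1 u * B powr R" using S by (intro mult_left_mono) auto
      also have "\<dots> \<le> max 1 u powr R * B powr R"
        using powr_mono[of 1 R "max 1 u"] R by (intro mult_right_mono) auto
      finally have "(a * real (n + 1) powr (u / R)) powr R \<le> (max 1 u * B) powr R"
        using R B by (simp add: powr_mult powr_powr a_def)
      then have "a * real (n + 1) powr (u / R) \<le> max 1 u * B"
        using R B by (smt (verit) powr_less_mono2 mult_nonneg_nonneg)
      then have "a \<le> max 1 u * B * real (n + 1) powr - (u / R)" by (simp add: powr_minus field_simps)
      moreover have "u / R = \<alpha> + d * recip r"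
        using R recip_finite[OF r False] by (simp add: u_def R_def field_simps)
      ultimately show ?thesis by (simp add: a_def n_def B_def)
    qed
  qed
  then show ?thesis by (intro exI[of _ "max 1 u"]) auto
qed

section \<open>The geodesic distance of a connected graph\<close>

lemma relpow_sym: "sym R \<Longrightarrow> (x, y) \<in> R ^^ n \<Longrightarrow> (y, x) \<in> R ^^ n"
proof (induction n arbitrary: x)
  case (Suc n)
  then obtain z where "(x, z) \<in> R" "(z, y) \<in> R ^^ n" by (meson relpow_Suc_D2)
  with Suc show ?case by (meson relpow_Suc_I symD)
qed simp

lemma sym_adjacency: "sym (adjacency E)"
  by (auto simp: sym_def adjacency_def insert_commute)

lemma geodesic_dist_relpow:
  assumes "connected_graph V E" "x \<in> V" "y \<in> V"
  shows "(x, y) \<in> adjacency E ^^ geodesic_dist E x y"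
proof -
  have "\<exists>n. (x, y) \<in> adjacency E ^^ n"
    using assms by (intro rtrancl_imp_relpow) (auto simp: connected_graph_def)
  then show ?thesis unfolding geodesic_dist_def by (rule LeastI_ex)
qed

lemma geodesic_dist_le: "(x, y) \<in> adjacency E ^^ n \<Longrightarrow> geodesic_dist E x y \<le> n"
  unfolding geodesic_dist_def by (rule Least_le)

text \<open>Growth forces balls to be finite, so that their measures are cardinalities;
  concatenating and reversing walks gives the triangle inequality and symmetry. The constants are
  enlarged to at least 1.\<close>

lemma doubling_space_graph:
  assumes conn: "connected_graph V E" and dbl: "doubling_graph V E" and gr: "growth_exponent V E d"
  shows "\<exists>D0 D1. doubling_space V (geodesic_dist E) D0 D1 d"
proof -
  have d: "d > 0" using gr by (simp add: growth_exponent_def)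
  obtain D1 where D1: "D1 > 0" and g: "\<And>x R. x \<in> V \<Longrightarrow> R \<ge> 0 \<Longrightarrow>
     emeasure (count_space V) (graph_ball V E x R) \<le> ennreal (D1 * (R + 1) powr d)"
    using gr by (auto simp: growth_exponent_def)
  obtain D0 where D0: "D0 > 0" and db: "\<And>x R. x \<in> V \<Longrightarrow> R \<ge> 0 \<Longrightarrow>
     emeasure (count_space V) (graph_ball V E x (2 * R))
       \<le> ennreal D0 * emeasure (count_space V) (graph_ball V E x R)"
    using dbl by (auto simp: doubling_graph_def)
  have sub: "graph_ball V E x R \<subseteq> V" for x R by (auto simp: graph_ball_def)
  have fin: "finite (graph_ball V E x R)" if x: "x \<in> V" for x R
  proof (rule ccontr)
    \<comment> \<open>The locale demands finiteness for every real R, whereas the growth bound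
      speaks of R \<ge> 0.\<close>
    have "graph_ball V E x R \<subseteq> graph_ball V E x \<bar>R\<bar>" by (auto simp: graph_ball_def)
    moreover assume "infinite (graph_ball V E x R)"
    ultimately have "infinite (graph_ball V E x \<bar>R\<bar>)" by (meson finite_subset)
    then have "emeasure (count_space V) (graph_ball V E x \<bar>R\<bar>) = \<infinity>"
      using sub by (intro emeasure_count_space_infinite)
    with g[OF x, of "\<bar>R\<bar>"] show False by (simp add: top_unique)
  qed
  have em: "emeasure (count_space V) (graph_ball V E x R) = ennreal (real (card (graph_ball V E x R)))"
    if "x \<in> V" for x R
    using emeasure_count_space_finite[OF sub fin[OF that]] by (simp add: ennreal_of_nat_eq_real_of_nat)
  have "doubling_space V (geodesic_dist E) (max 1 D0) (max 1 D1) d"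
  proof (unfold_locales, unfold graph_ball_def[symmetric])
    fix x y z assume x: "x \<in> V" and y: "y \<in> V" and z: "z \<in> V"
    have "(x, z) \<in> adjacency E ^^ (geodesic_dist E x y + geodesic_dist E y z)"
      unfolding relpow_add using geodesic_dist_relpow[OF conn x y] geodesic_dist_relpow[OF conn y z] by blast
    then show "geodesic_dist E x z \<le> geodesic_dist E x y + geodesic_dist E y z"
      by (rule geodesic_dist_le)
  next
    fix x y assume x: "x \<in> V" and y: "y \<in> V"
    show "geodesic_dist E x y = geodesic_dist E y x"
      using geodesic_dist_le[OF relpow_sym[OF sym_adjacency geodesic_dist_relpow[OF conn x y]]]
        geodesic_dist_le[OF relpow_sym[OF sym_adjacency geodesic_dist_relpow[OF conn y x]]]
      by (rule antisym[rotated])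
  next
    fix x assume "x \<in> V"
    have "geodesic_dist E x x \<le> 0" by (rule geodesic_dist_le) simp
    then show "geodesic_dist E x x = 0" by simp
  next
    fix x R assume x: "x \<in> V"
    show "finite (graph_ball V E x R)" using fin[OF x] .
    assume R: "(0::real) \<le> R"
    have "real (card (graph_ball V E x R)) \<le> D1 * (R + 1) powr d"
      using g[OF x R] D1 unfolding em[OF x] by (subst (asm) ennreal_le_iff) auto
    also have "\<dots> \<le> max 1 D1 * (R + 1) powr d" by (intro mult_right_mono) auto
    finally show "real (card (graph_ball V E x R)) \<le> max 1 D1 * (R + 1) powr d" .
    have "ennreal (real (card (graph_ball V E x (2 * R)))) \<le> ennreal (D0 * real (card (graph_ball V E x R)))"
      using db[OF x R] D0 unfolding em[OF x] by (simp add: ennreal_mult)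
    then have "real (card (graph_ball V E x (2 * R))) \<le> D0 * real (card (graph_ball V E x R))"
      using D0 by (subst (asm) ennreal_le_iff) auto
    also have "\<dots> \<le> max 1 D0 * real (card (graph_ball V E x R))" by (intro mult_right_mono) auto
    finally show "real (card (graph_ball V E x (2 * R))) \<le> max 1 D0 * real (card (graph_ball V E x R))" .
  qed (use d in auto)
  then show ?thesis by blast
qed

text \<open>Bernoulli's inequality 1 + C t \<le> (1 + t)^C. It carries the constant of the entry
  bound through the logarithm.\<close>

lemma log_factor_scale:
  assumes "C \<ge> 1" "t > 0"
  shows "log_factor s (C * t) \<le> C * log_factor s t"
proof (cases "s = 1")
  case True
  have "(1 + t) powr C \<ge> 1 + C * t"
  proof -
    have "\<exists>z>0. z < t \<and> (1 + t) powr C - (1 + 0) powr C = (t - 0) * (C * (1 + z) powr (C - 1))"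
      using assms by (intro MVT2) (auto intro!: derivative_eq_intros)
    then obtain z where z: "z > 0" "(1 + t) powr C = 1 + t * (C * (1 + z) powr (C - 1))" by auto
    have "t * (C * 1) \<le> t * (C * (1 + z) powr (C - 1))"
      using assms z by (intro mult_left_mono ge_one_powr_ge_zero) auto
    with z(2) show ?thesis by (simp add: mult.commute)
  qed
  then have "ln (1 + C * t) \<le> ln ((1 + t) powr C)"
    using assms by (subst ln_le_cancel_iff) (auto intro: add_pos_pos)
  then show ?thesis using True assms by (simp add: log_factor_def)
qed (use assms in \<open>simp add: log_factor_def\<close>)

theorem theorem4p1:
  fixes V :: "'a set" and E :: "'a set set"
    and r :: ennreal and d \<alpha> :: real and K\<^sub>0 :: nat
  assumes "1 \<le> r"
    and "simple_graph V E" and "connected_graph V E"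
    and "beurling_dimension V E d"
    and "doubling_graph V E"
    and "\<alpha> > d * recip (conjugate_exponent r)"
    and "K\<^sub>0 > 0"
    and "real K\<^sub>0 > d / min (\<alpha> - d * recip (conjugate_exponent r)) 1"
  shows "\<exists>C>0. \<forall>p q :: ennreal. \<forall>A \<in> beurling_class V E d r \<alpha>. \<forall>A\<^sub>p>0.
    1 \<le> p \<longrightarrow> 1 \<le> q \<longrightarrow> lp_stable V p A A\<^sub>p \<longrightarrow>
      (\<exists>A\<^sub>q>0. lp_stable V q A A\<^sub>q \<and>
        (\<alpha> \<noteq> 1 + d * recip (conjugate_exponent r) \<longrightarrow>
           enn2real (beurling_norm V E d r \<alpha> A) / A\<^sub>q
             \<le> C * (enn2real (beurling_norm V E d r \<alpha> A) / A\<^sub>p)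
                   powr ((1 + stability_theta d r \<alpha> K\<^sub>0 p q) ^ K\<^sub>0)) \<and>
        (\<alpha> = 1 + d * recip (conjugate_exponent r) \<longrightarrow>
           enn2real (beurling_norm V E d r \<alpha> A) / A\<^sub>q
             \<le> C * (enn2real (beurling_norm V E d r \<alpha> A) / A\<^sub>p
                    * ln (1 + enn2real (beurling_norm V E d r \<alpha> A) / A\<^sub>p))
                   powr ((1 + stability_theta d r \<alpha> K\<^sub>0 p q) ^ K\<^sub>0)))"
proof -
  have gr: "growth_exponent V E d" and d: "d > 0"
    using assms(4) by (auto simp: beurling_dimension_def growth_exponent_def)
  obtain D0 D1 where "doubling_space V (geodesic_dist E) D0 D1 d"
    using doubling_space_graph[OF assms(3,5) gr] by blast
  then interpret doubling_space V "geodesic_dist E" "\<lambda>x R. {y \<in> V. real (geodesic_dist E x y) \<le> R}" D0 D1 d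
    by simp_all
  have V: "V \<noteq> {}" using assms(3) by (simp add: connected_graph_def)
  define s where "s = \<alpha> - d * recip (conjugate_exponent r)"
  have s: "s > 0" using assms(6) by (simp add: s_def)
  have conj: "recip (conjugate_exponent r) = 1 - recip r" by (rule recip_conjugate_exponent[OF assms(1)])
  \<comment> \<open>By 1/r' = 1 - 1/r the decay exponent is the one of
    \<open>beurling_class_entry_bound\<close>.\<close>
  have ds: "d + s = \<alpha> + d * recip r" by (simp add: s_def conj algebra_simps)
  have \<alpha>: "\<alpha> > 0"
  proof -
    have "0 \<le> d * recip (conjugate_exponent r)"
      using d recip_bounds[OF assms(1)] by (simp add: conj)
    with assms(6) show ?thesis by linarith
  qed
  have s1: "s = 1 \<longleftrightarrow> \<alpha> = 1 + d * recip (conjugate_exponent r)" by (auto simp: s_def)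
  have dK: "d / real K\<^sub>0 < min s 1"
  proof -
    have "d / min s 1 < real K\<^sub>0" "min s 1 > 0" using assms(8) s by (simp_all add: s_def)
    then show ?thesis
      using assms(7) by (simp only: pos_divide_less_eq of_nat_0_less_iff mult.commute)
  qed
  obtain Cb where Cb: "Cb \<ge> 1" and entry: "\<forall>A\<in>beurling_class V E d r \<alpha>. \<forall>x\<in>V. \<forall>y\<in>V.
    norm (A x y) \<le> Cb * enn2real (beurling_norm V E d r \<alpha> A)
      * real (geodesic_dist E x y + 1) powr - (\<alpha> + d * recip r)"
    using beurling_class_entry_bound[OF assms(1) d \<alpha>, of V E] by (elim exE conjE)
  obtain t0 where t0: "t0 > 0" and t0_le: "\<And>p A W Ap. 1 \<le> p \<Longrightarrow> W > 0 \<Longrightarrow> Ap > 0 \<Longrightarrow> decay s W A \<Longrightarrow>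
      lp_stable V p A Ap \<Longrightarrow> t0 \<le> W / Ap"
    using stability_ratio_lower_bound[OF s V] by blast
  obtain C where C: "C \<ge> 1" and transfer: "\<And>p q A W Ap. 1 \<le> p \<Longrightarrow> 1 \<le> q \<Longrightarrow> W > 0 \<Longrightarrow> Ap > 0 \<Longrightarrow>
    decay s W A \<Longrightarrow> lp_stable V p A Ap \<Longrightarrow>
    (\<exists>Aq>0. lp_stable V q A Aq \<and>
      W / Aq \<le> C * (W / Ap * log_factor s (W / Ap)) powr
        ((1 + d * \<bar>recip p - recip q\<bar> / (real K\<^sub>0 * min s 1 - d * \<bar>recip p - recip q\<bar>)) ^ K\<^sub>0))"
    using stability_transfer[OF s V assms(7) dK] by blast
  \<comment> \<open>The value of \<theta>(p,q) at |1/p - 1/q| = 1, the largest possible.\<close>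
  define \<theta>m where "\<theta>m = d / (real K\<^sub>0 * min s 1 - d)"
  have Kd: "d < real K\<^sub>0 * min s 1"
    using dK assms(7) by (simp only: pos_divide_less_eq of_nat_0_less_iff mult.commute)
  \<comment> \<open>\<open>Cb\<close> comes out once from the ratio and once from the logarithm,
    hence the square; its exponent is bounded by the value at \<open>\<theta>m\<close>.\<close>
  define C' where "C' = C * (Cb ^ 2) powr ((1 + \<theta>m) ^ K\<^sub>0)"
  have C': "C' > 0" using C Cb by (simp add: C'_def)
  show ?thesis
  proof (rule exI[of _ C'], intro conjI allI ballI impI C')
    fix p q :: ennreal and A and Ap :: real
    assume A: "A \<in> beurling_class V E d r \<alpha>" and Ap: "0 < Ap" and p: "1 \<le> p" and q: "1 \<le> q"
      and st: "lp_stable V p A Ap"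
    define b where "b = enn2real (beurling_norm V E d r \<alpha> A)"
    have b: "b > 0"
    proof (rule ccontr)
      assume "\<not> b > 0"
      then have "b = 0" using enn2real_nonneg[of "beurling_norm V E d r \<alpha> A"] by (simp add: b_def)
      \<comment> \<open>With norm 0 all entries on V vanish, so decay holds with any positive W;
        this one violates \<open>t0 \<le> W / Ap\<close>.\<close>
      then have "decay s (t0 * Ap / 2) A"
        using bspec[OF entry A] t0 Ap by (auto simp: decay_def b_def)
      from t0_le[OF p _ Ap this st] t0 Ap show False by simp
    qed
    define W where "W = Cb * b"
    have W: "W > 0" using b Cb by (simp add: W_def)
    have "decay s W A" unfolding decay_def W_def b_def ds by (rule bspec[OF entry A])
    from transfer[OF p q W Ap this st] obtain Aq where Aq: "Aq > 0" "lp_stable V q A Aq"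
      and le: "W / Aq \<le> C * (W / Ap * log_factor s (W / Ap)) powr
        ((1 + d * \<bar>recip p - recip q\<bar> / (real K\<^sub>0 * min s 1 - d * \<bar>recip p - recip q\<bar>)) ^ K\<^sub>0)"
      by blast
    define \<theta> where "\<theta> = stability_theta d r \<alpha> K\<^sub>0 p q"
    have \<theta>_eq: "\<theta> = d * \<bar>recip p - recip q\<bar> / (real K\<^sub>0 * min s 1 - d * \<bar>recip p - recip q\<bar>)"
      by (simp add: \<theta>_def stability_theta_def s_def)
    have D: "\<bar>recip p - recip q\<bar> \<le> 1" using recip_bounds[OF p] recip_bounds[OF q] by auto
    then have dD: "d * \<bar>recip p - recip q\<bar> \<le> d" using d by (simp add: mult_left_le)
    have pos: "real K\<^sub>0 * min s 1 - d * \<bar>recip p - recip q\<bar> > 0" using dD Kd by linarith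
    have "\<theta> \<ge> 0" unfolding \<theta>_eq by (rule divide_nonneg_pos[OF _ pos]) (use d in simp)
    moreover have "\<theta> \<le> \<theta>m"
      unfolding \<theta>_eq \<theta>m_def
      by (rule frac_le[OF less_imp_le[OF d] dD]) (use dD Kd in linarith)+
    ultimately have \<theta>: "0 \<le> \<theta>" "\<theta> \<le> \<theta>m" by auto
    define e where "e = (1 + \<theta>) ^ K\<^sub>0"
    have e: "0 \<le> e" "e \<le> (1 + \<theta>m) ^ K\<^sub>0" using \<theta> by (auto simp: e_def intro: power_mono)
    define t where "t = b / Ap"
    have t: "t > 0" using b Ap by (simp add: t_def)
    have Wt: "W / Ap = Cb * t" by (simp add: W_def t_def)
    have "b / Aq \<le> W / Aq"
      using Cb b Aq mult_right_mono[of 1 Cb b] by (intro divide_right_mono) (auto simp: W_def)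
    also have "\<dots> \<le> C * (Cb * t * log_factor s (Cb * t)) powr e"
      using le unfolding Wt \<theta>_eq[symmetric] e_def .
    also have "\<dots> \<le> C * (Cb * t * (Cb * log_factor s t)) powr e"
      using log_factor_scale[OF Cb t] log_factor_pos[of "Cb * t" s] Cb t C e
      by (intro mult_left_mono powr_mono2) auto
    also have "\<dots> = C * (Cb ^ 2) powr e * (t * log_factor s t) powr e"
      using Cb t log_factor_pos[OF t, of s] by (simp add: powr_mult power2_eq_square mult_ac)
    also have "\<dots> \<le> C' * (t * log_factor s t) powr e"
      unfolding C'_def using C Cb e by (intro mult_right_mono mult_left_mono powr_mono) auto
    finally have main: "b / Aq \<le> C' * (t * log_factor s t) powr e" .
    show "\<exists>A\<^sub>q>0. lp_stable V q A A\<^sub>q \<and>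
        (\<alpha> \<noteq> 1 + d * recip (conjugate_exponent r) \<longrightarrow>
           enn2real (beurling_norm V E d r \<alpha> A) / A\<^sub>q
             \<le> C' * (enn2real (beurling_norm V E d r \<alpha> A) / Ap)
                   powr ((1 + stability_theta d r \<alpha> K\<^sub>0 p q) ^ K\<^sub>0)) \<and>
        (\<alpha> = 1 + d * recip (conjugate_exponent r) \<longrightarrow>
           enn2real (beurling_norm V E d r \<alpha> A) / A\<^sub>q
             \<le> C' * (enn2real (beurling_norm V E d r \<alpha> A) / Ap
                    * ln (1 + enn2real (beurling_norm V E d r \<alpha> A) / Ap))
                   powr ((1 + stability_theta d r \<alpha> K\<^sub>0 p q) ^ K\<^sub>0))"
      unfolding b_def[symmetric] \<theta>_def[symmetric] t_def[symmetric] e_def[symmetric] s1[symmetric]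
      using Aq main by (intro exI[of _ Aq]) (auto simp: log_factor_def)
  qed
qed

end
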